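(* Let $d,k,r$ be integers with $k\ge1$ and $1\le r\le d-2$, let $m=k(d-1)+r$, and let $\mu$ be the Cantor-like self-similar measure (of finite type) generated by the IFS $S_j(x)=\frac1d x+\frac{j}{md}(d-1)$, $j=0,\dots,m$, with probabilities $p_j>0$, $\sum_{j=0}^m p_j=1$. Then (terminology in the context): (1) The essential class consists of two reduced characteristic vectors: $E$, with normalized length $r/m$ and neighbour set $(j(d-1)/m: j=0,\dots,k)$, and $F$, with normalized length $(d-1-r)/m$ and neighbour set $((r+j(d-1))/m: j=0,\dots,k-1)$. (2) At level one the essential net intervals are, from left to right, alternately of type $E$ and $F$, beginning with the interval $\left[\frac1d-\frac r{md},\frac1d\right]$ of type $E$ and ending with $\left[1-\frac1d,1-\left(\frac1d-\frac r{md}\right)\right]$, also of type $E$. There are $m-k+1$ of type $E$ and $m-k$ of type $F$. (3) Type $E$ has $2r+1$ children, labelled from left to right $E^{(1)},F^{(2)},\dots,E^{(2r+1)}$ (alternately of types $E$ and $F$). Type $F$ has $2(d-r)-1$ children, labelled from left to right $F^{(1)},E^{(2)},\dots,F^{(2(d-r)-1)}$ (alternately of types $F$ and $E$). (4) The non-zero entries of the primitive transition matrices are as follows (rows and columns indexed from $0$, the index $x$ corresponding to the neighbour with $j=x$ in (1)): - for $i=0,\dots,r$ and $0\le x,y\le k$: $(T(E,E^{(2i+1)}))_{xy}=p_{dx-y+i}$ if $0\le dx-y+i\le m$; - for $i=1,\dots,r$, $0\le x\le k$, $0\le y\le k-1$: $(T(E,F^{(2i)}))_{xy}=p_{dx-y+i-1}$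 if $0\le dx-y+i-1\le m$; - for $i=0,\dots,d-r-1$ and $0\le x,y\le k-1$: $(T(F,F^{(2i+1)}))_{xy}=p_{dx+r-y+i}$ if $0\le dx+r-y+i\le m$; - for $i=1,\dots,d-r-1$, $0\le x\le k-1$, $0\le y\le k$: $(T(F,E^{(2i)}))_{xy}=p_{dx+r-y+i}$ if $0\le dx+r-y+i\le m$. All other entries are $0$.
   Context: Write $\varrho=1/d$, $\mathcal A=\{0,\dots,m\}$, and $S_\sigma=S_{j_1}\circ\cdots\circ S_{j_n}$ for $\sigma=(j_1,\dots,j_n)\in\mathcal A^n$. $\mu$ is the unique Borel probability measure with $\mu=\sum_j p_j\,\mu\circ S_j^{-1}$; its support is the self-similar set $K$, which here is $[0,1]$. Net intervals. Let $h_1<\dots<h_{s_n}$ be the elements of $\{S_\sigma(0),S_\sigma(1):\sigma\in\mathcal A^n\}$; the net intervals of level $n$ are the intervals $[h_j,h_{j+1}]$ with $(h_j,h_{j+1})\cap K\neq\emptyset$ (level $0$: $[0,1]$). Each net interval $\Delta$ of level $n\ge1$ is contained in a unique net interval $\widehat\Delta$ of level $n-1$, its parent ($\Delta$ is a child of $\widehat\Delta$). For a level $n$ net interval $\Delta=[a,b]$: normalized length $\ell_n(\Delta)=\varrho^{-n}(b-a)$; neighbour set $V_n(\Delta)$ = the increasingly ordered tuple of the distinct elements of $\{\varrho^{-n}(a-S_\sigma(0)):\sigma\in\mathcal A^n,\ \Delta\subseteq S_\sigma[0,1]\}$; $r_n(\Delta)$ = position of $\Delta$, from left to right, among the level $n$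 net intervals with the same parent and the same normalized length. The characteristic vector is $(\ell_n(\Delta),V_n(\Delta),r_n(\Delta))$ and the reduced characteristic vector is $(\ell_n(\Delta),V_n(\Delta))$. There are finitely many characteristic vectors (set $\Omega$), and those of the children depend only on that of the parent. A loop class is a non-empty $\Omega'\subseteq\Omega$ such that any $\alpha,\beta\in\Omega'$ are joined by a path from $\alpha$ to $\beta$ in $\Omega'$ in which each letter is the parent of the next; it is an essential class if moreover all children of elements of $\Omega'$ are in $\Omega'$. There is exactly one essential class (known); a net interval is essential if its characteristic vector lies in it. Primitive transition matrix. For a level $n$ net interval $\Delta=[a,b]$ with parent $\widehat\Delta=[c,c']$, $V_n(\Delta)=(a_1,\dots,a_N)$, $V_{n-1}(\widehat\Delta)=(c_1,\dots,c_M)$, it is the $M\times N$ matrix whose $jl$ entry is $p_w$ if there are $w\in\mathcal A$ and $\sigma\in\mathcal A^{n-1}$ with $S_\sigma(0)=c-\varrho^{n-1}c_j$ and $S_{\sigma w}(0)=a-\varrho^n a_l$, and $0$ otherwise.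
   Formalization: In (2) a net interval counts as essential when its reduced characteristic vector (position dropped) occurs in the essential class; with the full vector (2) fails, e.g. d=3, k=r=1: level-one positions reach 5, but positions in the class are at most 3. *)

theory Defs
  imports "HOL-Probability.Probability" "Jordan_Normal_Form.Matrix"
begin

section \<open>The IFS and its self-similar measure\<close>

definition S :: "nat \<Rightarrow> nat \<Rightarrow> nat \<Rightarrow> real \<Rightarrow> real" where
  "S d m j x = x / real d + real j / (real m * real d) * (real d - 1)"

definition words :: "nat \<Rightarrow> nat \<Rightarrow> nat list set" where
  "words m n = {\<sigma>. length \<sigma> = n \<and> set \<sigma> \<subseteq> {0..m}}"

definition S_word :: "nat \<Rightarrow> nat \<Rightarrow> nat list \<Rightarrow> real \<Rightarrow> real" where
  "S_word d m \<sigma> = foldr (\<circ>) (map (S d m) \<sigma>) id"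

definition self_similar_measure :: "nat \<Rightarrow> nat \<Rightarrow> (nat \<Rightarrow> real) \<Rightarrow> real measure \<Rightarrow> bool" where
  "self_similar_measure d m p \<mu> \<longleftrightarrow>
     prob_space \<mu> \<and> sets \<mu> = sets borel \<and>
     (\<forall>B \<in> sets borel. measure \<mu> B = (\<Sum>j = 0..m. p j * measure \<mu> (S d m j -` B)))"

definition supp_measure :: "real measure \<Rightarrow> real set" where
  "supp_measure \<mu> = {x. \<forall>U. open U \<longrightarrow> x \<in> U \<longrightarrow> 0 < measure \<mu> U}"


section \<open>Net intervals\<close>

text \<open>An interval \<open>[a,b]\<close> is represented by the pair \<open>(a,b)\<close>.  The parameter \<open>K\<close> is the
  self-similar set, i.e. the support of the self-similar measure.\<close>

definition endpts :: "nat \<Rightarrow> nat \<Rightarrow> nat \<Rightarrow> real set" where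
  "endpts d m n = (\<lambda>\<sigma>. S_word d m \<sigma> 0) ` words m n \<union> (\<lambda>\<sigma>. S_word d m \<sigma> 1) ` words m n"

definition net :: "nat \<Rightarrow> nat \<Rightarrow> real set \<Rightarrow> nat \<Rightarrow> (real \<times> real) set" where
  "net d m K n = {(a, b). a \<in> endpts d m n \<and> b \<in> endpts d m n \<and> a < b \<and>
     {a<..<b} \<inter> endpts d m n = {} \<and> {a<..<b} \<inter> K \<noteq> {}}"

definition subinterval :: "real \<times> real \<Rightarrow> real \<times> real \<Rightarrow> bool" where
  "subinterval \<Delta> \<Delta>' \<longleftrightarrow> {fst \<Delta>..snd \<Delta>} \<subseteq> {fst \<Delta>'..snd \<Delta>'}"

text \<open>For \<open>n = 0\<close> truncated subtraction makes \<open>[0,1]\<close> its own parent; this only has the effect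
  that its position (below) is 1.\<close>

definition parent :: "nat \<Rightarrow> nat \<Rightarrow> real set \<Rightarrow> nat \<Rightarrow> real \<times> real \<Rightarrow> real \<times> real" where
  "parent d m K n \<Delta> = (THE \<Delta>'. \<Delta>' \<in> net d m K (n - 1) \<and> subinterval \<Delta> \<Delta>')"

definition children :: "nat \<Rightarrow> nat \<Rightarrow> real set \<Rightarrow> nat \<Rightarrow> real \<times> real \<Rightarrow> (real \<times> real) set" where
  "children d m K n \<Delta> = {\<Delta>' \<in> net d m K (Suc n). parent d m K (Suc n) \<Delta>' = \<Delta>}"

definition lists_left_to_right :: "(real \<times> real) list \<Rightarrow> (real \<times> real) set \<Rightarrow> bool" where
  "lists_left_to_right xs A \<longleftrightarrow> set xs = A \<and> sorted_wrt (<) (map fst xs)"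


section \<open>Characteristic vectors\<close>

definition norm_length :: "nat \<Rightarrow> nat \<Rightarrow> real \<times> real \<Rightarrow> real" where
  "norm_length d n \<Delta> = real d ^ n * (snd \<Delta> - fst \<Delta>)"

definition neighbours :: "nat \<Rightarrow> nat \<Rightarrow> nat \<Rightarrow> real \<times> real \<Rightarrow> real list" where
  "neighbours d m n \<Delta> = sorted_list_of_set
     ((\<lambda>\<sigma>. real d ^ n * (fst \<Delta> - S_word d m \<sigma> 0)) `
        {\<sigma> \<in> words m n. {fst \<Delta>..snd \<Delta>} \<subseteq> S_word d m \<sigma> ` {0..1}})"

definition position :: "nat \<Rightarrow> nat \<Rightarrow> real set \<Rightarrow> nat \<Rightarrow> real \<times> real \<Rightarrow> nat" where
  "position d m K n \<Delta> = card {\<Delta>' \<in> net d m K n.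
     parent d m K n \<Delta>' = parent d m K n \<Delta> \<and> norm_length d n \<Delta>' = norm_length d n \<Delta> \<and>
     fst \<Delta>' \<le> fst \<Delta>}"

type_synonym reduced_vector = "real \<times> real list"
type_synonym char_vector = "reduced_vector \<times> nat"

definition red_vec :: "nat \<Rightarrow> nat \<Rightarrow> nat \<Rightarrow> real \<times> real \<Rightarrow> reduced_vector" where
  "red_vec d m n \<Delta> = (norm_length d n \<Delta>, neighbours d m n \<Delta>)"

definition char_vec :: "nat \<Rightarrow> nat \<Rightarrow> real set \<Rightarrow> nat \<Rightarrow> real \<times> real \<Rightarrow> char_vector" where
  "char_vec d m K n \<Delta> = (red_vec d m n \<Delta>, position d m K n \<Delta>)"

definition char_vecs :: "nat \<Rightarrow> nat \<Rightarrow> real set \<Rightarrow> char_vector set" where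
  "char_vecs d m K = (\<Union>n. char_vec d m K n ` net d m K n)"

definition parent_rel :: "nat \<Rightarrow> nat \<Rightarrow> real set \<Rightarrow> (char_vector \<times> char_vector) set" where
  "parent_rel d m K = {(char_vec d m K n \<Delta>, char_vec d m K (Suc n) \<Delta>') | n \<Delta> \<Delta>'.
     \<Delta> \<in> net d m K n \<and> \<Delta>' \<in> children d m K n \<Delta>}"


section \<open>The essential class\<close>

definition loop_class :: "nat \<Rightarrow> nat \<Rightarrow> real set \<Rightarrow> char_vector set \<Rightarrow> bool" where
  "loop_class d m K X \<longleftrightarrow> X \<noteq> {} \<and> X \<subseteq> char_vecs d m K \<and>
     (\<forall>\<alpha> \<in> X. \<forall>\<beta> \<in> X. (\<alpha>, \<beta>) \<in> (parent_rel d m K \<inter> X \<times> X)\<^sup>+)"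

definition is_essential_class :: "nat \<Rightarrow> nat \<Rightarrow> real set \<Rightarrow> char_vector set \<Rightarrow> bool" where
  "is_essential_class d m K X \<longleftrightarrow> loop_class d m K X \<and>
     (\<forall>\<alpha> \<in> X. \<forall>\<beta>. (\<alpha>, \<beta>) \<in> parent_rel d m K \<longrightarrow> \<beta> \<in> X)"

definition essential_class :: "nat \<Rightarrow> nat \<Rightarrow> real set \<Rightarrow> char_vector set" where
  "essential_class d m K = (THE X. is_essential_class d m K X)"

definition reduced_essential_class :: "nat \<Rightarrow> nat \<Rightarrow> real set \<Rightarrow> reduced_vector set" where
  "reduced_essential_class d m K = fst ` essential_class d m K"

text \<open>Whether a net interval is essential is decided by its reduced characteristic vector.  The
  position has to be dropped here: an interval of the same type as an element of the essential
  class, but with more equally long siblings to its left than ever occur below an interval in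
  the class, would otherwise fail to be essential although all its descendants are.  (For
  \<open>d = 3\<close>, \<open>m = 3\<close> the positions in the essential class are at most 3, whereas those of the
  level 1 net intervals \<open>[2/9,3/9], \<dots>, [6/9,7/9]\<close> are \<open>1, \<dots>, 5\<close>.)\<close>

definition essential_net :: "nat \<Rightarrow> nat \<Rightarrow> real set \<Rightarrow> nat \<Rightarrow> (real \<times> real) set" where
  "essential_net d m K n = {\<Delta> \<in> net d m K n. red_vec d m n \<Delta> \<in> reduced_essential_class d m K}"

definition type_E :: "nat \<Rightarrow> nat \<Rightarrow> nat \<Rightarrow> nat \<Rightarrow> reduced_vector" where
  "type_E d k r m = (real r / real m, map (\<lambda>j. real j * (real d - 1) / real m) [0..<k+1])"

definition type_F :: "nat \<Rightarrow> nat \<Rightarrow> nat \<Rightarrow> nat \<Rightarrow> reduced_vector" where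
  "type_F d k r m =
     ((real d - 1 - real r) / real m, map (\<lambda>j. (real r + real j * (real d - 1)) / real m) [0..<k])"


section \<open>Primitive transition matrices\<close>

text \<open>Here \<open>\<Delta>\<close> has level \<open>n\<close> and its child \<open>\<Delta>'\<close> level \<open>n + 1\<close>.\<close>

definition trans_letter ::
  "nat \<Rightarrow> nat \<Rightarrow> nat \<Rightarrow> real \<times> real \<Rightarrow> real \<times> real \<Rightarrow> nat \<Rightarrow> nat \<Rightarrow> nat \<Rightarrow> bool" where
  "trans_letter d m n \<Delta> \<Delta>' j l w \<longleftrightarrow> w \<in> {0..m} \<and>
     (\<exists>\<sigma> \<in> words m n.
        S_word d m \<sigma> 0 = fst \<Delta> - (neighbours d m n \<Delta> ! j) / real d ^ n \<and>
        S_word d m (\<sigma> @ [w]) 0 = fst \<Delta>' - (neighbours d m (Suc n) \<Delta>' ! l) / real d ^ Suc n)"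

definition prim_trans ::
  "nat \<Rightarrow> nat \<Rightarrow> (nat \<Rightarrow> real) \<Rightarrow> nat \<Rightarrow> real \<times> real \<Rightarrow> real \<times> real \<Rightarrow> real mat" where
  "prim_trans d m p n \<Delta> \<Delta>' =
     mat (length (neighbours d m n \<Delta>)) (length (neighbours d m (Suc n) \<Delta>'))
       (\<lambda>(j, l). if \<exists>w. trans_letter d m n \<Delta> \<Delta>' j l w
                 then p (THE w. trans_letter d m n \<Delta> \<Delta>' j l w) else 0)"

text \<open>The value \<open>p\<^sub>i\<close>, with the convention that it is \<open>0\<close> for \<open>i\<close> outside \<open>{0,\<dots>,m}\<close>.\<close>

definition p_ext :: "nat \<Rightarrow> (nat \<Rightarrow> real) \<Rightarrow> int \<Rightarrow> real" where
  "p_ext m p i = (if 0 \<le> i \<and> i \<le> int m then p (nat i) else 0)"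

end

theory Submission
  imports Defs
begin

text \<open>
  Multiplied by \<open>m d\<^sup>n\<close>, the end points of level \<open>n\<close> are integers: with \<open>D = d - 1\<close>, the left end points
  are the \<open>D N\<close> and the right ones the \<open>D N + m = D (N + k) + r\<close>, where \<open>N\<close> runs through all
  integers from \<open>0\<close> to \<open>M\<^sub>n = m (d\<^sup>n - 1) / (d - 1)\<close> because \<open>m \<ge> d - 1\<close>.  Between \<open>D k\<close> and
  \<open>D M\<^sub>n + r\<close> both kinds alternate, with gaps \<open>r\<close> (type \<open>E\<close>) and \<open>D - r\<close> (type \<open>F\<close>); all other
  gaps have length at least \<open>D\<close>.  Passing to level \<open>n + 1\<close> multiplies these integers by \<open>d\<close>, so children,
  neighbours and transition matrices can be read off.

  The children of an interval depend only on its type, and each type has both types among its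
  children.  So the characteristic vectors of all children of intervals of type \<open>E\<close> or \<open>F\<close> form an
  essential class.  It is the only one, since every net interval has a descendant of type \<open>E\<close>.
\<close>

section \<open>Words as affine maps and as integers\<close>

lemma S_word_Nil [simp]: "S_word d m [] x = x"
  by (simp add: S_word_def)

lemma S_word_Cons [simp]: "S_word d m (j # \<sigma>) x = S d m j (S_word d m \<sigma> x)"
  by (simp add: S_word_def)

lemma S_word_snoc: "S_word d m (\<sigma> @ [w]) x = S_word d m \<sigma> (S d m w x)"
  by (induction \<sigma>) auto

text \<open>The word is read as a base \<open>d\<close> numeral, last letter least significant.
  Letters run up to \<open>m\<close>, so different words may share a number.\<close>

definition word_num :: "nat \<Rightarrow> nat list \<Rightarrow> int" where
  "word_num d \<sigma> = foldl (\<lambda>N j. int d * N + int j) 0 \<sigma>"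

lemma word_num_Nil [simp]: "word_num d [] = 0"
  and word_num_snoc [simp]: "word_num d (\<sigma> @ [w]) = int d * word_num d \<sigma> + int w"
  by (simp_all add: word_num_def)

text \<open>An appended letter acts innermost, so induction from the right, with \<open>x\<close>
  arbitrary, uses the hypothesis at \<open>S d m w x\<close>.\<close>

lemma S_word_affine:
  assumes "d > 0" "m > 0"
  shows "S_word d m \<sigma> x =
    (real m * x + (real d - 1) * real_of_int (word_num d \<sigma>)) / (real m * real d ^ length \<sigma>)"
proof (induction \<sigma> arbitrary: x rule: rev_induct)
  case Nil
  then show ?case using assms by simp
next
  case (snoc w \<sigma>)
  have "real m * S d m w x = (real m * x + real w * (real d - 1)) / real d"
    using assms by (simp add: S_def field_simps)
  then show ?case
    unfolding S_word_snoc snoc.IH \<open>real m * S d m w x = _\<close> using assms by (simp add: field_simps)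
qed

lemma words_Suc: "words m (Suc n) = {\<sigma> @ [w] | \<sigma> w. \<sigma> \<in> words m n \<and> w \<le> m}"
proof -
  have "\<exists>\<tau> w. \<sigma> = \<tau> @ [w] \<and> \<tau> \<in> words m n \<and> w \<le> m" if "\<sigma> \<in> words m (Suc n)" for \<sigma>
    using that by (cases \<sigma> rule: rev_cases) (auto simp: words_def)
  then show ?thesis
    by (auto simp: words_def)
qed

section \<open>The support of the measure\<close>

text \<open>Self-similarity bounds the mass of \<open>B\<close> below by \<open>p j\<close> times
  the mass of its preimage under \<open>S d m j\<close>; this is iterated along the word.\<close>

lemma measure_pos_if_preimage_pos:
  assumes \<mu>: "self_similar_measure d m p \<mu>" and p: "\<And>j. j \<le> m \<Longrightarrow> p j > 0"
    and \<sigma>: "set \<sigma> \<subseteq> {0..m}" and B: "B \<in> sets borel"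
    and pos: "0 < measure \<mu> (S_word d m \<sigma> -` B)"
  shows "0 < measure \<mu> B"
  using \<sigma> B pos
proof (induction \<sigma> arbitrary: B)
  case Nil
  then show ?case by (simp add: vimage_def)
next
  case (Cons j \<sigma>)
  have j: "j \<in> {0..m}" using Cons.prems by simp
  have "S d m j \<in> borel_measurable borel"
    unfolding S_def by measurable
  then have SB: "S d m j -` B \<in> sets borel"
    using Cons.prems(2) by (metis measurable_sets_borel)
  have eq: "S_word d m (j # \<sigma>) -` B = S_word d m \<sigma> -` (S d m j -` B)"
    by auto
  have "0 < measure \<mu> (S d m j -` B)"
    using Cons.IH[OF _ SB] Cons.prems(1,3) unfolding eq by simp
  then have "0 < p j * measure \<mu> (S d m j -` B)"
    using p j by simp
  also have "\<dots> \<le> (\<Sum>i = 0..m. p i * measure \<mu> (S d m i -` B))"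
    using j p by (intro member_le_sum) (auto intro: mult_nonneg_nonneg simp: less_imp_le)
  also have "\<dots> = measure \<mu> B"
    using \<mu> Cons.prems(2) by (simp add: self_similar_measure_def)
  finally show ?case .
qed

section \<open>Arithmetic of the parameters and the range of word numbers\<close>

locale cantor_ifs =
  fixes d k r m :: nat
  assumes k: "k \<ge> 1" and r: "1 \<le> r" "r + 2 \<le> d"
    and m: "m = k * (d - 1) + r"
begin

definition D :: int where "D = int d - 1"

lemma int_d: "int d = D + 1" and real_d: "real d = real_of_int D + 1"
  by (simp_all add: D_def)

lemma r_less_D: "int r < D" and D_gt1: "1 < D" and r_pos: "0 < int r"
  using r by (auto simp: D_def)

lemma int_m: "int m = int k * D + int r"
  using r m by (simp add: D_def of_nat_diff)

lemma d_pos: "d > 0" and m_pos: "m > 0"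
  using r m by auto

lemma D_less_m: "D < int m"
proof -
  have "1 * D \<le> int k * D" using k D_gt1 by (intro mult_right_mono) auto
  then show ?thesis using int_m r_pos by linarith
qed

lemma k_less_m: "int k < int m"
proof -
  have "int k * 1 \<le> int k * D" using D_gt1 by (intro mult_left_mono) auto
  then show ?thesis using int_m r_pos by linarith
qed

text \<open>The largest number of a word of length \<open>n\<close>, attained when every letter is
  \<open>m\<close>.\<close>

primrec M :: "nat \<Rightarrow> int" where
  "M 0 = 0"
| "M (Suc n) = int d * M n + int m"

lemma M_nonneg [simp]: "0 \<le> M n"
  by (induction n) auto

text \<open>The left side is the scaled right end of the cylinder of the word of letters
  \<open>m\<close>; that end is 1 because \<open>S d m m\<close> fixes 1.\<close>

lemma M_scale: "D * M n + int m = int m * int d ^ n"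
proof (induction n)
  case (Suc n)
  have "D * M (Suc n) + int m = int d * (D * M n + int m)"
    by (simp add: int_d algebra_simps)
  then show ?case by (simp add: Suc.IH)
qed simp

text \<open>No integer is skipped: the numbers \<open>d * N\<close> are \<open>d\<close> apart, and
  the last letter already provides all remainders since \<open>d - 1 < m\<close>.\<close>

lemma word_num_image: "word_num d ` words m n = {0..M n}"
proof (induction n)
  case 0
  have "words m 0 = {[]}" by (auto simp: words_def)
  then show ?case by simp
next
  case (Suc n)
  have "word_num d ` words m (Suc n) = {int d * N + int w | N w. N \<in> {0..M n} \<and> w \<le> m}"
    unfolding Suc.IH[symmetric] words_Suc by force
  also have "\<dots> = {0..M (Suc n)}"
  proof (intro equalityI subsetI)
    fix x assume "x \<in> {int d * N + int w | N w. N \<in> {0..M n} \<and> w \<le> m}"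
    then obtain N w where x: "x = int d * N + int w" "0 \<le> N" "N \<le> M n" "w \<le> m" by auto
    have "int d * N \<le> int d * M n" using x by (intro mult_left_mono) auto
    then show "x \<in> {0..M (Suc n)}" using x by simp
  next
    fix x assume x: "x \<in> {0..M (Suc n)}"
    show "x \<in> {int d * N + int w | N w. N \<in> {0..M n} \<and> w \<le> m}"
    proof (cases "x \<le> int d * M n")
      case True
      have "x div int d \<le> M n"
        using True d_pos by (metis nonzero_mult_div_cancel_left of_nat_0_less_iff zdiv_mono1 less_numeral_extra(3))
      moreover have "0 \<le> x div int d"
        using x d_pos by (simp add: pos_imp_zdiv_nonneg_iff)
      moreover have "x mod int d < int d" "0 \<le> x mod int d" using d_pos by auto
      ultimately have "x = int d * (x div int d) + int (nat (x mod int d))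
          \<and> x div int d \<in> {0..M n} \<and> nat (x mod int d) \<le> m"
        using D_less_m int_d by auto
      then show ?thesis by blast
    next
      \<comment> \<open>Here the quotient by \<open>d\<close> may exceed \<open>M n\<close>, so the
        prefix is kept at \<open>M n\<close> and the excess, at most \<open>m\<close>, becomes the
        last letter.\<close>
      case False
      then have "x = int d * M n + int (nat (x - int d * M n)) \<and> M n \<in> {0..M n}
          \<and> nat (x - int d * M n) \<le> m"
        using x by auto
      then show ?thesis by blast
    qed
  qed
  finally show ?case .
qed

lemma S_word_eq:
  assumes "\<sigma> \<in> words m n"
  shows "S_word d m \<sigma> x = real_of_int (D * word_num d \<sigma>) / (real m * real d ^ n) + x / real d ^ n"
  using assms S_word_affine[OF d_pos m_pos, of \<sigma> x] m_pos d_pos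
  by (simp add: words_def D_def field_simps)

text \<open>Some bounded interval \<open>[-R, R]\<close> has positive mass. A long word whose
  cylinder starts close to \<open>x\<close> maps it into the given neighbourhood of
  \<open>x\<close>, which therefore has positive mass as well.\<close>

lemma unit_interval_subset_supp:
  assumes \<mu>: "self_similar_measure d m p \<mu>" and p: "\<And>j. j \<le> m \<Longrightarrow> p j > 0"
  shows "{0..1} \<subseteq> supp_measure \<mu>"
proof
  fix x :: real assume x: "x \<in> {0..1}"
  interpret prob_space \<mu> using \<mu> by (simp add: self_similar_measure_def)
  have sets: "sets \<mu> = sets borel" using \<mu> by (simp add: self_similar_measure_def)
  have "(\<lambda>i. measure \<mu> {- real i..real i}) \<longlonglongrightarrow> measure \<mu> (\<Union>i. {- real i..real i})"
    by (rule finite_Lim_measure_incseq) (auto simp: sets incseq_def)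
  moreover have "(\<Union>i. {- real i..real i}) = UNIV"
    by (auto simp: abs_le_iff) (metis abs_le_iff minus_le_iff real_nat_ceiling_ge abs_ge_zero real_arch_simple)
  moreover have "measure \<mu> UNIV = 1"
    using prob_space sets by (metis sets_eq_imp_space_eq space_borel)
  ultimately have "(\<lambda>i. measure \<mu> {- real i..real i}) \<longlonglongrightarrow> 1" by simp
  then have "eventually (\<lambda>i. measure \<mu> {- real i..real i} > 0) sequentially"
    by (rule order_tendstoD) simp
  then obtain R where R: "measure \<mu> {- real R..real R} > 0"
    by (auto simp: eventually_sequentially)
  show "x \<in> supp_measure \<mu>"
    unfolding supp_measure_def
  proof (intro CollectI allI impI)
    fix U :: "real set" assume U: "open U" "x \<in> U"
    then obtain e where e: "e > 0" "ball x e \<subseteq> U" by (meson openE)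
    \<comment> \<open>In scaled distance the image of \<open>[-R, R]\<close> stays within
      \<open>R + 1\<close> of \<open>x\<close>: at most 1 for the choice of the cylinder and
      \<open>R\<close> for the interval.\<close>
    obtain n where n: "real R + 1 < real d ^ n * e"
    proof -
      have "1 < real d" using r by simp
      then obtain n where "(real R + 1) / e < real d ^ n" using real_arch_pow by blast
      then show ?thesis using e that by (simp add: divide_less_eq)
    qed
    define y where "y = real m * real d ^ n * x"
    \<comment> \<open>The last left end point not beyond \<open>x\<close>, capped at
      \<open>M n\<close> because \<open>x\<close> may lie far inside the last cylinder. In either
      case the scaled error is at most \<open>m\<close>: by \<open>D < m\<close>, or because that
      cylinder ends at 1.\<close>
    define N where "N = min (M n) \<lfloor>y / real_of_int D\<rfloor>"
    have D: "0 < real_of_int D" using D_gt1 by simp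
    have y: "0 \<le> y" "y \<le> real_of_int (D * M n) + real m"
    proof -
      show "0 \<le> y" using x by (simp add: y_def)
      have "y \<le> real m * real d ^ n * 1" unfolding y_def using x by (intro mult_left_mono) auto
      also have "\<dots> = real_of_int (D * M n + int m)" unfolding M_scale by simp
      finally show "y \<le> real_of_int (D * M n) + real m" by simp
    qed
    have "N \<in> {0..M n}" using y D by (auto simp: N_def)
    then obtain \<sigma> where \<sigma>: "\<sigma> \<in> words m n" "word_num d \<sigma> = N"
      unfolding word_num_image[symmetric] by auto
    have fl: "real_of_int D * real_of_int \<lfloor>y / D\<rfloor> \<le> y" "y < real_of_int D * real_of_int \<lfloor>y / D\<rfloor> + D"
      using D floor_divide_lower[of D y] floor_divide_upper[of D y] by (auto simp: algebra_simps)
    have "real_of_int D \<le> real m" using D_less_m by linarith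
    then have N: "\<bar>real_of_int (D * N) - y\<bar> \<le> real m"
    proof (cases "M n \<le> \<lfloor>y / D\<rfloor>")
      case True
      then have "real_of_int D * real_of_int (M n) \<le> real_of_int D * real_of_int \<lfloor>y / D\<rfloor>"
        using D by (intro mult_left_mono) auto
      then have "real_of_int D * real_of_int (M n) \<le> y" using fl(1) by linarith
      then show ?thesis using True y by (simp add: N_def abs_le_iff)
    next
      case False
      then show ?thesis using fl \<open>real_of_int D \<le> real m\<close> by (simp add: N_def abs_le_iff)
    qed
    have sub: "{- real R..real R} \<subseteq> S_word d m \<sigma> -` U"
    proof
      fix z assume z: "z \<in> {- real R..real R}"
      have "real d ^ n * (S_word d m \<sigma> z - x) = (real_of_int (D * N) - y) / real m + z"
        using m_pos d_pos \<sigma> by (simp add: S_word_eq[OF \<sigma>(1)] y_def field_simps)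
      moreover have "\<bar>(real_of_int (D * N) - y) / real m\<bar> \<le> 1"
        using N m_pos by simp
      moreover have "\<bar>q + z\<bar> \<le> 1 + real R" if "\<bar>q\<bar> \<le> 1" for q
        using z that by auto
      ultimately have "\<bar>real d ^ n * (S_word d m \<sigma> z - x)\<bar> \<le> 1 + real R"
        by presburger
      then have "real d ^ n * \<bar>S_word d m \<sigma> z - x\<bar> < real d ^ n * e"
        using n by (simp add: abs_mult)
      then have "\<bar>S_word d m \<sigma> z - x\<bar> < e" using d_pos by simp
      then show "z \<in> S_word d m \<sigma> -` U"
        using e by (auto simp: dist_real_def ball_def abs_minus_commute)
    qed
    have "S_word d m \<sigma> \<in> borel_measurable borel"
      using S_word_eq[OF \<sigma>(1), abs_def] by simp
    then have "S_word d m \<sigma> -` U \<in> sets borel"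
      using U by (metis borel_open measurable_sets_borel)
    then have "0 < measure \<mu> (S_word d m \<sigma> -` U)"
      using R finite_measure_mono[OF sub] sets by simp
    then show "0 < measure \<mu> U"
      using measure_pos_if_preimage_pos[OF \<mu> p, of \<sigma> U] \<sigma>(1) U by (auto simp: words_def)
  qed
qed

section \<open>Indexing the end points by integers\<close>

lemma int_parity_cases:
  fixes u :: int
  obtains (even) t where "u = 2 * t" | (odd) t where "u = 2 * t + 1"
  by (metis evenE oddE)

text \<open>The left end points \<open>D N\<close> get the even index \<open>2 N\<close> and the right end points
  \<open>D (N + k) + r\<close> the odd index \<open>2 (N + k) + 1\<close>, which makes the point an increasing function
  of the index.\<close>

definition node :: "int \<Rightarrow> int" where
  "node u = D * (u div 2) + int r * (u mod 2)"

lemma node_even [simp]: "node (2 * t) = D * t"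
  and node_odd [simp]: "node (2 * t + 1) = D * t + int r"
  by (simp_all add: node_def)

text \<open>Consecutive nodes differ by \<open>r\<close> and \<open>D - r\<close> in turn, and
  \<open>0 < r < D\<close>.\<close>

lemma node_less: "node u < node v" if "u < v"
proof (cases "u div 2 = v div 2")
  case True
  then have "u mod 2 = 0" "v mod 2 = 1" using that by presburger+
  then show ?thesis using True r_pos by (simp add: node_def)
next
  case False
  then have "u div 2 + 1 \<le> v div 2" using that by presburger
  then have "D * (u div 2 + 1) \<le> D * (v div 2)" using D_gt1 by (intro mult_left_mono) auto
  moreover have "int r * (u mod 2) \<le> int r * 1" by (intro mult_left_mono) auto
  moreover have "0 \<le> int r * (v mod 2)" by simp
  ultimately show ?thesis
    using r_less_D unfolding node_def distrib_left mult_1_right by linarith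
qed

definition nd :: "nat \<Rightarrow> int \<Rightarrow> real" where
  "nd n u = real_of_int (node u) / (real m * real d ^ n)"

text \<open>This turns order questions about real end points into order questions about integer
  indices.\<close>

lemma strict_mono_nd: "strict_mono (nd n)"
  using m_pos d_pos by (auto intro!: strict_monoI divide_strict_right_mono simp: nd_def node_less)

lemmas nd_less [simp] = strict_mono_less[OF strict_mono_nd]
  and nd_le [simp] = strict_mono_less_eq[OF strict_mono_nd]
  and nd_eq [simp] = strict_mono_eq[OF strict_mono_nd]

lemma node_last: "node (2 * (M n + int k) + 1) = int m * int d ^ n"
  using M_scale[of n] unfolding node_odd by (simp add: int_m algebra_simps)

lemma nd_0: "nd n 0 = 0"
  by (simp add: nd_def node_def)

lemma nd_last: "nd n (2 * (M n + int k) + 1) = 1"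
  using m_pos d_pos unfolding nd_def node_last by simp

text \<open>The index at level \<open>n + 1\<close> of the point with index \<open>u\<close> at level \<open>n\<close>.\<close>

definition refine :: "int \<Rightarrow> int" where
  "refine u = 2 * int d * (u div 2) + (2 * int r + 1) * (u mod 2)"

lemma refine_even [simp]: "refine (2 * t) = 2 * (int d * t)"
  and refine_odd [simp]: "refine (2 * t + 1) = 2 * (int d * t + int r) + 1"
  by (simp_all add: refine_def)

text \<open>For odd indices \<open>d * (D * t + r) = D * (d * t + r) + r\<close>, as
  \<open>d = D + 1\<close>; this explains the odd case of \<open>refine\<close>.\<close>

lemma node_refine: "node (refine u) = int d * node u"
proof (cases u rule: int_parity_cases)
  case (even t)
  then show ?thesis unfolding even refine_even node_even by simp
next
  case (odd t)
  then show ?thesis unfolding odd refine_odd node_odd by (simp add: int_d algebra_simps)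
qed

lemma nd_refine: "nd (Suc n) (refine u) = nd n u"
  using m_pos d_pos unfolding nd_def node_refine by (simp add: field_simps)

lemma refine_less [simp]: "refine u < refine v \<longleftrightarrow> u < v"
  and refine_le [simp]: "refine u \<le> refine v \<longleftrightarrow> u \<le> v"
  by (metis nd_less nd_refine) (metis nd_le nd_refine)

lemma refine_0 [simp]: "refine 0 = 0"
  by (simp add: refine_def)

lemma refine_last: "refine (2 * (M n + int k) + 1) = 2 * (M (Suc n) + int k) + 1"
  by (metis nd_eq nd_last nd_refine)

section \<open>The end points and candidate net intervals of a level\<close>

text \<open>Odd members start only at \<open>2 * k + 1\<close> and even ones stop at
  \<open>2 * M n\<close>, so the two kinds alternate only in between.\<close>

definition idx :: "nat \<Rightarrow> int set" where
  "idx n = (\<lambda>N. 2 * N) ` {0..M n} \<union> (\<lambda>N. 2 * (N + int k) + 1) ` {0..M n}"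

lemma even_in_idx [simp]: "2 * t \<in> idx n \<longleftrightarrow> 0 \<le> t \<and> t \<le> M n"
proof -
  have "2 * t \<noteq> 2 * (N + int k) + 1" for N by presburger
  then show ?thesis by (auto simp: idx_def)
qed

lemma odd_in_idx [simp]: "2 * t + 1 \<in> idx n \<longleftrightarrow> int k \<le> t \<and> t \<le> M n + int k"
proof -
  have "2 * t + 1 \<noteq> 2 * N" for N by presburger
  moreover have "t = (t - int k) + int k" by simp
  ultimately show ?thesis by (auto simp: idx_def image_iff intro!: bexI[of _ "t - int k"])
qed

lemma finite_idx: "finite (idx n)"
  by (simp add: idx_def)

lemma idx_bounds: "u \<in> idx n \<Longrightarrow> 0 \<le> u \<and> u \<le> 2 * (M n + int k) + 1"
  by (cases u rule: int_parity_cases) auto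

text \<open>Since \<open>S d m 0\<close> fixes 0 and \<open>S d m m\<close> fixes 1, appending the
  letter 0 or \<open>m\<close> keeps a left or right end point. In the odd case the upper bound is
  preserved exactly, by \<open>m = k * D + r\<close>.\<close>

lemma refine_in_idx:
  assumes "u \<in> idx n" shows "refine u \<in> idx (Suc n)"
proof (cases u rule: int_parity_cases)
  case (even t)
  then have "0 \<le> t" "t \<le> M n" using assms by auto
  then have "0 \<le> int d * t" "int d * t \<le> int d * M n" by (auto intro: mult_left_mono)
  then show ?thesis using even by simp
next
  case (odd t)
  then have t: "int k \<le> t" "t \<le> M n + int k" using assms by auto
  have "1 * t \<le> int d * t" using t d_pos by (intro mult_right_mono) auto
  moreover have "int d * t \<le> int d * (M n + int k)" using t by (intro mult_left_mono) auto
  ultimately have "int k \<le> int d * t + int r" "int d * t + int r \<le> M (Suc n) + int k"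
    using t by (auto simp: int_m int_d algebra_simps)
  then show ?thesis unfolding odd refine_odd odd_in_idx by simp
qed

lemma S_word_eq_nd:
  assumes "\<sigma> \<in> words m n"
  shows "S_word d m \<sigma> 0 = nd n (2 * word_num d \<sigma>)"
    and "S_word d m \<sigma> 1 = nd n (2 * (word_num d \<sigma> + int k) + 1)"
proof -
  show "S_word d m \<sigma> 0 = nd n (2 * word_num d \<sigma>)"
    by (simp add: S_word_eq[OF assms] nd_def)
  have "node (2 * (word_num d \<sigma> + int k) + 1) = D * word_num d \<sigma> + int m"
    unfolding node_odd by (simp add: int_m algebra_simps)
  then show "S_word d m \<sigma> 1 = nd n (2 * (word_num d \<sigma> + int k) + 1)"
    unfolding nd_def using m_pos d_pos by (simp add: S_word_eq[OF assms] field_simps)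
qed

lemma S_word_image:
  assumes "\<sigma> \<in> words m n"
  shows "S_word d m \<sigma> ` {0..1} = {nd n (2 * word_num d \<sigma>)..nd n (2 * (word_num d \<sigma> + int k) + 1)}"
proof -
  let ?c = "real_of_int (D * word_num d \<sigma>) / (real m * real d ^ n)"
  have "S_word d m \<sigma> = (\<lambda>x. (1 / real d ^ n) * x + ?c)"
    using S_word_eq[OF assms] by (auto simp: fun_eq_iff)
  then have "S_word d m \<sigma> ` {0..1} = {S_word d m \<sigma> 0..S_word d m \<sigma> 1}"
    using image_affinity_atLeastAtMost[of "1 / real d ^ n" ?c 0 "1 :: real"] by simp
  then show ?thesis using S_word_eq_nd[OF assms] by simp
qed

lemma endpts_eq: "endpts d m n = nd n ` idx n"
proof -
  have "endpts d m n = (\<lambda>\<sigma>. nd n (2 * word_num d \<sigma>)) ` words m n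
      \<union> (\<lambda>\<sigma>. nd n (2 * (word_num d \<sigma> + int k) + 1)) ` words m n"
    using S_word_eq_nd by (simp add: endpts_def)
  also have "\<dots> = nd n ` idx n"
    unfolding idx_def word_num_image[symmetric] image_Un image_image ..
  finally show ?thesis .
qed

definition left_pt :: "nat \<Rightarrow> int \<Rightarrow> real" where
  "left_pt n N = nd n (2 * N)"

lemma left_pt_eq [simp]: "left_pt n N = left_pt n N' \<longleftrightarrow> N = N'"
  by (simp add: left_pt_def)

lemma S_word_0: "\<sigma> \<in> words m n \<Longrightarrow> S_word d m \<sigma> 0 = left_pt n (word_num d \<sigma>)"
  by (simp add: S_word_eq_nd left_pt_def)

text \<open>Even \<open>u\<close> give the net intervals of type \<open>E\<close>, odd \<open>u\<close> those of type \<open>F\<close>.\<close>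

definition piece :: "nat \<Rightarrow> int \<Rightarrow> real \<times> real" where
  "piece n u = (nd n u, nd n (u + 1))"

text \<open>By the next two lemmas these are the \<open>u\<close> for which both \<open>u\<close>
  and \<open>u + 1\<close> index end points. The set is empty at level 0.\<close>

definition ess :: "nat \<Rightarrow> int set" where
  "ess n = {2 * int k..2 * M n}"

lemma ess_idx: assumes "u \<in> ess n" shows "u \<in> idx n" "u + 1 \<in> idx n"
proof -
  show "u \<in> idx n" using assms by (cases u rule: int_parity_cases) (auto simp: ess_def)
  show "u + 1 \<in> idx n"
  proof (cases u rule: int_parity_cases)
    case (odd t)
    then have u: "u + 1 = 2 * (t + 1)" by simp
    show ?thesis unfolding u even_in_idx using assms odd by (simp add: ess_def)
  qed (use assms in \<open>auto simp: ess_def\<close>)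
qed

lemma idx_ess:
  assumes "u \<in> idx n" "u + 1 \<in> idx n" shows "u \<in> ess n"
proof (cases u rule: int_parity_cases)
  case (odd t)
  then have "u + 1 = 2 * (t + 1)" by simp
  then have "2 * (t + 1) \<in> idx n" using assms(2) by metis
  then have "t + 1 \<le> M n" unfolding even_in_idx by simp
  then show ?thesis using assms(1) odd by (simp add: ess_def)
qed (use assms in \<open>auto simp: ess_def\<close>)

section \<open>Lengths and neighbours\<close>

definition ptype :: "int \<Rightarrow> reduced_vector" where
  "ptype u = (if even u then type_E d k r m else type_F d k r m)"

text \<open>The number of neighbours has to decide, since the lengths agree when
  \<open>2 * r = d - 1\<close>.\<close>

lemma type_E_neq_type_F: "type_E d k r m \<noteq> type_F d k r m"
proof
  assume "type_E d k r m = type_F d k r m"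
  then have "length (snd (type_E d k r m)) = length (snd (type_F d k r m))" by simp
  then show False by (simp add: type_E_def type_F_def)
qed

lemma ptype_eq_iff: "ptype u = ptype v \<longleftrightarrow> (even u \<longleftrightarrow> even v)"
  using type_E_neq_type_F by (auto simp: ptype_def)

lemma ptype_even: "ptype (2 * t) = type_E d k r m"
  and ptype_odd: "ptype (2 * t + 1) = type_F d k r m"
  by (simp_all add: ptype_def)

text \<open>The bound separates both types from all other net intervals, whose normalized lengths
  are at least \<open>D / m\<close>.\<close>

lemma fst_ptype_less: "fst (ptype u) < real_of_int D / real m"
proof -
  have "real r < real_of_int D" "real d - 1 - real r < real_of_int D"
    using r by (auto simp: D_def)
  then show ?thesis
    using m_pos by (simp add: ptype_def type_E_def type_F_def divide_strict_right_mono)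
qed

lemma norm_length_nd: "norm_length d n (nd n u, nd n v) = real_of_int (node v - node u) / real m"
  using m_pos d_pos by (simp add: norm_length_def nd_def diff_divide_distrib right_diff_distrib)

lemma norm_length_piece: "norm_length d n (piece n u) = fst (ptype u)"
proof (cases u rule: int_parity_cases)
  case (odd t)
  then have "u + 1 = 2 * (t + 1)" by simp
  then have "node (u + 1) = D * (t + 1)" by (simp only: node_even)
  then show ?thesis unfolding odd piece_def norm_length_nd node_odd ptype_odd
    by (simp add: type_F_def real_d algebra_simps)
qed (simp add: piece_def norm_length_nd ptype_even type_E_def)

text \<open>Entry \<open>j\<close> of the neighbour set; the term with \<open>u mod 2\<close> is the
  shift by \<open>r\<close> of type F.\<close>

definition offset :: "int \<Rightarrow> nat \<Rightarrow> real" where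
  "offset u j = real_of_int (int j * D + int r * (u mod 2)) / real m"

definition nbs :: "int \<Rightarrow> nat" where
  "nbs u = (if even u then k + 1 else k)"

lemma snd_ptype: "snd (ptype u) = map (offset u) [0..<nbs u]"
proof (cases u rule: int_parity_cases)
  case (even t)
  then show ?thesis by (simp add: ptype_even type_E_def nbs_def offset_def D_def)
next
  case (odd t)
  then show ?thesis unfolding odd ptype_odd
    by (simp add: type_F_def nbs_def offset_def D_def algebra_simps)
qed

lemma offset_scaled:
  "real d ^ n * (nd n u - left_pt n (u div 2 - int j)) = offset u j"
proof -
  have "node u - node (2 * (u div 2 - int j)) = int j * D + int r * (u mod 2)"
    unfolding node_even node_def[of u] by (simp add: algebra_simps)
  then have "nd n u - left_pt n (u div 2 - int j)
      = real_of_int (int j * D + int r * (u mod 2)) / (real m * real d ^ n)"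
    unfolding nd_def left_pt_def diff_divide_distrib[symmetric] of_int_diff[symmetric] by simp
  then show ?thesis using d_pos by (simp add: offset_def)
qed

text \<open>With \<open>N\<close> the number of the word, covering means
  \<open>2 * N \<le> u\<close> and \<open>u + 1 \<le> 2 * (N + k) + 1\<close>. So
  \<open>u div 2 - N\<close> runs from 0 to \<open>k\<close>, where \<open>k\<close> is excluded for
  odd \<open>u\<close>.\<close>

lemma covering_words_iff:
  assumes "\<sigma> \<in> words m n"
  shows "{fst (piece n u)..snd (piece n u)} \<subseteq> S_word d m \<sigma> ` {0..1}
    \<longleftrightarrow> (\<exists>j < nbs u. word_num d \<sigma> = u div 2 - int j)" (is "?L \<longleftrightarrow> ?R")
proof -
  let ?N = "word_num d \<sigma>"
  have "?L \<longleftrightarrow> 2 * ?N \<le> u \<and> u \<le> 2 * (?N + int k)"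
    unfolding S_word_image[OF assms] piece_def by simp
  also have "\<dots> \<longleftrightarrow> 0 \<le> u div 2 - ?N \<and> u div 2 - ?N < int (nbs u)"
    by (cases u rule: int_parity_cases) (auto simp: nbs_def)
  also have "\<dots> \<longleftrightarrow> ?R"
    by (auto intro!: exI[of _ "nat (u div 2 - ?N)"])
  finally show ?thesis .
qed

text \<open>On \<open>ess n\<close> every candidate number lies in \<open>{0..M n}\<close>, so no
  neighbour is missing near 0 or 1.\<close>

lemma ess_neighbour_exists:
  assumes "u \<in> ess n" "j < nbs u"
  obtains \<sigma> where "\<sigma> \<in> words m n" "word_num d \<sigma> = u div 2 - int j"
proof -
  have "u div 2 - int j \<in> {0..M n}"
    using assms by (cases u rule: int_parity_cases) (auto simp: nbs_def ess_def)
  then show ?thesis using that unfolding word_num_image[symmetric] by auto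
qed

lemma neighbours_piece:
  assumes "u \<in> ess n"
  shows "neighbours d m n (piece n u) = snd (ptype u)"
proof -
  have "(\<lambda>\<sigma>. real d ^ n * (fst (piece n u) - S_word d m \<sigma> 0)) `
      {\<sigma> \<in> words m n. {fst (piece n u)..snd (piece n u)} \<subseteq> S_word d m \<sigma> ` {0..1}}
      = offset u ` {0..<nbs u}" (is "?g ` ?W = _")
  proof (intro equalityI subsetI)
    fix y assume "y \<in> ?g ` ?W"
    then obtain \<sigma> j where \<sigma>: "\<sigma> \<in> words m n" "y = ?g \<sigma>" "j < nbs u" "word_num d \<sigma> = u div 2 - int j"
      using covering_words_iff by blast
    then have "y = offset u j" by (simp add: S_word_0 piece_def offset_scaled)
    then show "y \<in> offset u ` {0..<nbs u}" using \<sigma> by simp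
  next
    fix y assume "y \<in> offset u ` {0..<nbs u}"
    then obtain j where j: "j < nbs u" "y = offset u j" by auto
    then obtain \<sigma> where \<sigma>: "\<sigma> \<in> words m n" "word_num d \<sigma> = u div 2 - int j"
      using ess_neighbour_exists assms by blast
    then have "y = ?g \<sigma>" using j by (simp add: S_word_0 piece_def offset_scaled)
    then show "y \<in> ?g ` ?W" using \<sigma> j covering_words_iff[OF \<sigma>(1)] by blast
  qed
  also have "\<dots> = set (snd (ptype u))" by (simp add: snd_ptype)
  finally have "neighbours d m n (piece n u) = sorted_list_of_set (set (snd (ptype u)))"
    by (simp add: neighbours_def)
  \<comment> \<open>The offsets increase strictly in \<open>j\<close>, so sorting the set returns
    the list itself.\<close>
  moreover have "sorted_wrt (<) (snd (ptype u))"
    using m_pos D_gt1 by (auto simp: snd_ptype sorted_wrt_map sorted_wrt_iff_nth_less offset_def divide_strict_right_mono)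
  ultimately show ?thesis
    by (simp add: sorted_list_of_set.idem_if_sorted_distinct strict_sorted_iff)
qed

lemma red_vec_piece: "u \<in> ess n \<Longrightarrow> red_vec d m n (piece n u) = ptype u"
  by (simp add: red_vec_def norm_length_piece neighbours_piece)

section \<open>Primitive transition matrices in terms of indices\<close>

lemma left_end_minus_neighbour:
  assumes "u \<in> ess n" "j < nbs u"
  shows "fst (piece n u) - neighbours d m n (piece n u) ! j / real d ^ n
    = left_pt n (u div 2 - int j)"
proof -
  have "neighbours d m n (piece n u) ! j = offset u j"
    using assms by (simp add: neighbours_piece snd_ptype)
  also have "\<dots> = real d ^ n * (nd n u - left_pt n (u div 2 - int j))"
    by (simp only: offset_scaled)
  finally show ?thesis using d_pos by (simp add: piece_def)
qed

text \<open>Appending \<open>w\<close> turns the number \<open>N\<close> into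
  \<open>d * N + w\<close>, so the numbers of the two neighbours force the letter. A word with the
  required number exists, which gives the converse.\<close>

lemma trans_letter_iff:
  assumes u: "u \<in> ess n" "x < nbs u" and v: "v \<in> ess (Suc n)" "y < nbs v"
  shows "trans_letter d m n (piece n u) (piece (Suc n) v) x y w
    \<longleftrightarrow> w \<le> m \<and> int w = v div 2 - int y - int d * (u div 2 - int x)"
proof -
  obtain \<sigma> where \<sigma>: "\<sigma> \<in> words m n" "word_num d \<sigma> = u div 2 - int x"
    using ess_neighbour_exists[OF u] by blast
  have snoc: "S_word d m (\<tau> @ [w]) 0 = left_pt (Suc n) (word_num d (\<tau> @ [w]))"
    if "\<tau> \<in> words m n" "w \<le> m" for \<tau>
    using that by (intro S_word_0) (auto simp: words_Suc)
  have "trans_letter d m n (piece n u) (piece (Suc n) v) x y w \<longleftrightarrow> w \<le> m \<and>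
     (\<exists>\<sigma> \<in> words m n. word_num d \<sigma> = u div 2 - int x \<and>
        word_num d (\<sigma> @ [w]) = v div 2 - int y)"
    unfolding trans_letter_def left_end_minus_neighbour[OF u] left_end_minus_neighbour[OF v]
    by (auto simp: snoc S_word_0 simp del: word_num_snoc)
  also have "\<dots> \<longleftrightarrow> w \<le> m \<and> int w = v div 2 - int y - int d * (u div 2 - int x)"
    using \<sigma> by (auto intro!: bexI[of _ \<sigma>])
  finally show ?thesis .
qed

lemma prim_trans_piece:
  assumes u: "u \<in> ess n" and v: "v \<in> ess (Suc n)"
  shows "prim_trans d m p n (piece n u) (piece (Suc n) v) =
    mat (nbs u) (nbs v) (\<lambda>(x, y). p_ext m p (v div 2 - int y - int d * (u div 2 - int x)))"
proof -
  let ?T = "trans_letter d m n (piece n u) (piece (Suc n) v)"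
  have "(if \<exists>w. ?T x y w then p (THE w. ?T x y w) else 0)
      = p_ext m p (v div 2 - int y - int d * (u div 2 - int x))" (is "_ = p_ext m p ?W")
    if "x < nbs u" "y < nbs v" for x y
  proof (cases "0 \<le> ?W \<and> ?W \<le> int m")
    case True
    have "w \<le> m \<and> int w = W \<longleftrightarrow> w = nat W" if "0 \<le> W \<and> W \<le> int m" for w W
      using that by auto
    \<comment> \<open>Exactly one letter qualifies, so the definite description in
      \<open>prim_trans\<close> denotes it.\<close>
    then have T: "?T x y = (\<lambda>w. w = nat ?W)"
      unfolding fun_eq_iff trans_letter_iff[OF u(1) that(1) v(1) that(2)] using True by blast
    show ?thesis unfolding T using True by (simp add: p_ext_def)
  next
    case False
    have "\<not> (w \<le> m \<and> int w = W)" if "\<not> (0 \<le> W \<and> W \<le> int m)" for w W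
      using that by auto
    then have "\<not> ?T x y w" for w
      unfolding trans_letter_iff[OF u(1) that(1) v(1) that(2)] using False by blast
    then show ?thesis using False by (auto simp: p_ext_def)
  qed
  then show ?thesis
    unfolding prim_trans_def using neighbours_piece[OF u] neighbours_piece[OF v]
    by (intro eq_matI) (auto simp: snd_ptype)
qed

end

section \<open>Net intervals\<close>

locale cantor_net = cantor_ifs +
  fixes K :: "real set"
  assumes K: "{0..1} \<subseteq> K"
begin

lemma net_iff:
  "\<Delta> \<in> net d m K n \<longleftrightarrow>
    (\<exists>u v. \<Delta> = (nd n u, nd n v) \<and> u \<in> idx n \<and> v \<in> idx n \<and> u < v \<and> {u<..<v} \<inter> idx n = {})"
proof -
  \<comment> \<open>The midpoint lies in \<open>[0,1]\<close>, hence in \<open>K\<close>; it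
    witnesses the condition on \<open>K\<close> in \<open>net\<close>.\<close>
  have mid: "{nd n u<..<nd n v} \<inter> K \<noteq> {}" if "u \<in> idx n" "v \<in> idx n" "u < v" for u v
  proof -
    have "nd n 0 \<le> nd n u" "nd n v \<le> nd n (2 * (M n + int k) + 1)" "nd n u < nd n v"
      using idx_bounds that unfolding nd_le nd_less by auto
    then have "(nd n u + nd n v) / 2 \<in> {nd n u<..<nd n v} \<inter> K"
      using subsetD[OF K, of "(nd n u + nd n v) / 2"] unfolding nd_0 nd_last
      by (simp del: nd_less nd_le)
    then show ?thesis by blast
  qed
  have gap: "{nd n u<..<nd n v} \<inter> nd n ` idx n = {} \<longleftrightarrow> {u<..<v} \<inter> idx n = {}" for u v
    unfolding disjoint_iff image_iff greaterThanLessThan_iff by (metis nd_less)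
  show ?thesis
  proof
    assume "\<Delta> \<in> net d m K n"
    then obtain u v where "\<Delta> = (nd n u, nd n v)" "u \<in> idx n" "v \<in> idx n" "nd n u < nd n v"
        "{nd n u<..<nd n v} \<inter> nd n ` idx n = {}"
      unfolding net_def endpts_eq by blast
    then show "\<exists>u v. \<Delta> = (nd n u, nd n v) \<and> u \<in> idx n \<and> v \<in> idx n \<and> u < v \<and> {u<..<v} \<inter> idx n = {}"
      unfolding gap nd_less by blast
  next
    assume "\<exists>u v. \<Delta> = (nd n u, nd n v) \<and> u \<in> idx n \<and> v \<in> idx n \<and> u < v \<and> {u<..<v} \<inter> idx n = {}"
    then obtain u v where uv: "\<Delta> = (nd n u, nd n v)" "u \<in> idx n" "v \<in> idx n" "u < v"
        "{u<..<v} \<inter> idx n = {}"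
      by blast
    then have "{nd n u<..<nd n v} \<inter> nd n ` idx n = {}" unfolding gap by blast
    moreover have "nd n u < nd n v" using uv by simp
    ultimately show "\<Delta> \<in> net d m K n"
      using uv mid[of u v] unfolding net_def endpts_eq by blast
  qed
qed

lemma piece_net: "u \<in> ess n \<Longrightarrow> piece n u \<in> net d m K n"
  unfolding net_iff piece_def using ess_idx[of u n]
  by (intro exI[of _ u] exI[of _ "u + 1"]) auto

lemma subinterval_nd:
  "u < v \<Longrightarrow> subinterval (nd n u, nd n v) (nd n u', nd n v') \<longleftrightarrow> u' \<le> u \<and> v \<le> v'"
  by (simp add: subinterval_def)

text \<open>If two different net intervals of one level overlapped, an end point of one would lie
  strictly inside the other.\<close>

lemma net_overlap:
  assumes \<Delta>: "\<Delta>1 \<in> net d m K n" "\<Delta>2 \<in> net d m K n"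
    and sub: "subinterval \<Delta> \<Delta>1" "subinterval \<Delta> \<Delta>2" and "fst \<Delta> < snd \<Delta>"
  shows "\<Delta>1 = \<Delta>2"
proof -
  obtain u1 v1 where 1: "\<Delta>1 = (nd n u1, nd n v1)" "u1 \<in> idx n" "v1 \<in> idx n" "{u1<..<v1} \<inter> idx n = {}"
    using \<Delta>(1) net_iff by blast
  obtain u2 v2 where 2: "\<Delta>2 = (nd n u2, nd n v2)" "u2 \<in> idx n" "v2 \<in> idx n" "{u2<..<v2} \<inter> idx n = {}"
    using \<Delta>(2) net_iff by blast
  have "nd n u1 < nd n v2" "nd n u2 < nd n v1"
    using sub \<open>fst \<Delta> < snd \<Delta>\<close> 1(1) 2(1) by (auto simp: subinterval_def simp del: nd_less)
  then have lt: "u1 < v2" "u2 < v1" by simp_all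
  have "\<not> u1 < u2" "\<not> u2 < u1" "\<not> v1 < v2" "\<not> v2 < v1"
    using lt 1 2 by (auto simp: disjoint_iff)
  then show ?thesis using 1 2 by simp
qed

lemma net_nonempty: "\<Delta> \<in> net d m K n \<Longrightarrow> fst \<Delta> < snd \<Delta>"
  unfolding net_iff by auto

text \<open>The interval sought is spanned by the last level \<open>n\<close> end point not beyond
  the left end of \<open>\<Delta>'\<close> and the first one after it.\<close>

lemma net_Suc_subinterval:
  assumes "\<Delta>' \<in> net d m K (Suc n)"
  shows "\<exists>\<Delta> \<in> net d m K n. subinterval \<Delta>' \<Delta>"
proof -
  obtain u v where uv: "\<Delta>' = (nd (Suc n) u, nd (Suc n) v)" "u \<in> idx (Suc n)" "v \<in> idx (Suc n)" "u < v"
      "{u<..<v} \<inter> idx (Suc n) = {}"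
    using assms net_iff by blast
  let ?A = "{a \<in> idx n. refine a \<le> u}" and ?B = "{b \<in> idx n. u < refine b}"
  have "0 \<in> idx n" using even_in_idx[of 0 n] by simp
  then have A: "finite ?A" "?A \<noteq> {}"
    using idx_bounds[OF uv(2)] finite_idx by auto
  have "2 * (M n + int k) + 1 \<in> idx n" unfolding odd_in_idx by simp
  moreover have "u < refine (2 * (M n + int k) + 1)"
    using idx_bounds[OF uv(3)] uv(4) unfolding refine_last by linarith
  ultimately have B: "finite ?B" "?B \<noteq> {}" using finite_idx by auto
  define a b where "a = Max ?A" and "b = Min ?B"
  have a: "a \<in> idx n" "refine a \<le> u" using Max_in[OF A] by (auto simp: a_def)
  have b: "b \<in> idx n" "u < refine b" using Min_in[OF B] by (auto simp: b_def)
  have "refine a < refine b" using a b by linarith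
  then have "a < b" by simp
  have "c \<le> a \<or> b \<le> c" if "c \<in> idx n" for c
    using Max_ge[OF A(1), of c] Min_le[OF B(1), of c] that unfolding a_def b_def by fastforce
  then have "{a<..<b} \<inter> idx n = {}" by force
  then have "(nd n a, nd n b) \<in> net d m K n"
    using a b \<open>a < b\<close> net_iff by blast
  \<comment> \<open>The point \<open>refine b\<close> is an end point of level \<open>n + 1\<close>
    beyond \<open>u\<close>, and none lies strictly between \<open>u\<close> and
    \<open>v\<close>.\<close>
  moreover have "v \<le> refine b"
    using uv b refine_in_idx[OF b(1)] by (force simp: disjoint_iff)
  then have "subinterval \<Delta>' (nd n a, nd n b)"
    unfolding uv(1) nd_refine[of n, symmetric] using uv(4) a by (simp add: subinterval_nd)
  ultimately show ?thesis by blast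
qed

section \<open>Parents and children\<close>

lemma parent_unique:
  assumes "\<Delta>' \<in> net d m K (Suc n)" "\<Delta> \<in> net d m K n" "subinterval \<Delta>' \<Delta>"
  shows "parent d m K (Suc n) \<Delta>' = \<Delta>"
  unfolding parent_def
proof (rule the_equality)
  fix \<Delta>2 assume "\<Delta>2 \<in> net d m K (Suc n - 1) \<and> subinterval \<Delta>' \<Delta>2"
  then show "\<Delta>2 = \<Delta>"
    using net_overlap[of \<Delta>2 n \<Delta> \<Delta>'] assms net_nonempty[OF assms(1)] by simp
qed (use assms in simp)

lemma mem_children_iff:
  assumes "\<Delta> \<in> net d m K n"
  shows "\<Delta>' \<in> children d m K n \<Delta> \<longleftrightarrow> \<Delta>' \<in> net d m K (Suc n) \<and> subinterval \<Delta>' \<Delta>"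
proof -
  have "subinterval \<Delta>' \<Delta>" if "\<Delta>' \<in> net d m K (Suc n)" "parent d m K (Suc n) \<Delta>' = \<Delta>"
    using net_Suc_subinterval[OF that(1)] parent_unique[OF that(1)] that(2) by blast
  then show ?thesis
    using parent_unique[OF _ assms] unfolding children_def by blast
qed

text \<open>The lower bound \<open>2 * k\<close> is refined to \<open>2 * d * k\<close>, and the
  last index below an essential interval is \<open>2 * (d * M n + r)\<close>; as
  \<open>r \<le> m\<close>, both lie in the new range.\<close>

lemma refine_range_ess:
  assumes "u \<in> ess n" "refine u \<le> v" "v < refine (u + 1)"
  shows "v \<in> ess (Suc n)"
proof -
  have "refine (2 * int k) \<le> refine u" "refine (u + 1) \<le> refine (2 * M n + 1)"
    using assms(1) unfolding refine_le ess_def by auto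
  then have v: "2 * (int d * int k) \<le> v" "v \<le> 2 * (int d * M n + int r)"
    using assms(2,3) unfolding refine_even refine_odd by linarith+
  have "1 * int k \<le> int d * int k" using d_pos by (intro mult_right_mono) auto
  then have "2 * int k \<le> v" using v(1) by linarith
  moreover have "int r \<le> int m" using m by simp
  then have "2 * (int d * M n + int r) \<le> 2 * (int d * M n + int m)" by simp
  with v(2) have "v \<le> 2 * (int d * M n + int m)" by (rule order_trans)
  ultimately show ?thesis by (simp add: ess_def)
qed

text \<open>The refined range lies in \<open>ess (Suc n)\<close>, so each index in it is an end
  point. A child must therefore end one index after it starts.\<close>

lemma children_piece:
  assumes "u \<in> ess n"
  shows "children d m K n (piece n u) = piece (Suc n) ` {refine u..<refine (u + 1)}"
proof (intro equalityI subsetI)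
  fix \<Delta>' assume "\<Delta>' \<in> children d m K n (piece n u)"
  then have \<Delta>': "\<Delta>' \<in> net d m K (Suc n)" "subinterval \<Delta>' (piece n u)"
    using mem_children_iff[OF piece_net[OF assms]] by auto
  obtain a b where ab: "\<Delta>' = (nd (Suc n) a, nd (Suc n) b)" "a < b" "b \<in> idx (Suc n)"
      "{a<..<b} \<inter> idx (Suc n) = {}"
    using \<Delta>'(1) net_iff by blast
  have le: "refine u \<le> a" "b \<le> refine (u + 1)"
    using \<Delta>'(2) ab unfolding piece_def nd_refine[of n, symmetric] by (simp_all add: subinterval_nd)
  then have "a \<in> ess (Suc n)" using refine_range_ess[OF assms, of a] ab by simp
  then have "a + 1 \<in> idx (Suc n)" by (rule ess_idx)
  then have "a + 1 \<notin> {a<..<b}" using ab by blast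
  then have "b = a + 1" using ab by simp
  then show "\<Delta>' \<in> piece (Suc n) ` {refine u..<refine (u + 1)}"
    using ab le by (auto simp: piece_def)
next
  fix \<Delta>' assume "\<Delta>' \<in> piece (Suc n) ` {refine u..<refine (u + 1)}"
  then obtain v where v: "\<Delta>' = piece (Suc n) v" "refine u \<le> v" "v < refine (u + 1)" by auto
  have "subinterval \<Delta>' (piece n u)"
    using v unfolding v(1) piece_def nd_refine[of n, symmetric] by (simp add: subinterval_nd)
  then show "\<Delta>' \<in> children d m K n (piece n u)"
    using mem_children_iff[OF piece_net[OF assms]] piece_net[OF refine_range_ess[OF assms v(2,3)]] v by simp
qed

text \<open>As \<open>node (u + 2) = node u + D\<close>, a length below \<open>D / m\<close> forces
  consecutive indices; the full reduced vector then determines the parity.\<close>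

lemma red_vec_ptypeE:
  assumes "\<Delta> \<in> net d m K n" "red_vec d m n \<Delta> = ptype w"
  obtains u where "u \<in> ess n" "\<Delta> = piece n u" "even u \<longleftrightarrow> even w"
proof -
  obtain u v where uv: "\<Delta> = (nd n u, nd n v)" "u \<in> idx n" "v \<in> idx n" "u < v"
    using assms(1) net_iff by blast
  have "norm_length d n \<Delta> = fst (ptype w)"
    using assms(2) by (metis fst_conv red_vec_def)
  then have "real_of_int (node v - node u) / real m < real_of_int D / real m"
    using fst_ptype_less[of w] unfolding uv(1) norm_length_nd by simp
  then have "real_of_int (node v - node u) < real_of_int D"
    using m_pos by (simp add: divide_less_cancel)
  then have "node v < node u + D" by linarith
  also have "node u + D = node (u + 2)" by (simp add: node_def algebra_simps)
  finally have "\<not> u + 2 \<le> v" using node_less[of "u + 2" v] by force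
  then have v: "v = u + 1" using uv by simp
  then have u: "u \<in> ess n" using idx_ess uv by simp
  moreover have \<Delta>: "\<Delta> = piece n u" using uv v by (simp add: piece_def)
  moreover have "even u \<longleftrightarrow> even w"
    using assms(2) red_vec_piece[OF u] \<Delta> by (simp add: ptype_eq_iff)
  ultimately show ?thesis using that by blast
qed

section \<open>Characteristic vectors and the essential class\<close>

text \<open>The number of children of \<open>piece n u\<close>, by
  \<open>children_piece\<close>.\<close>

definition width :: "int \<Rightarrow> int" where
  "width u = refine (u + 1) - refine u"

lemma width_even: "even u \<Longrightarrow> width u = 2 * int r + 1"
proof (elim evenE)
  fix t assume u: "u = 2 * t"
  show ?thesis unfolding width_def u refine_even refine_odd by simp
qed

lemma width_odd: "odd u \<Longrightarrow> width u = 2 * (int d - int r) - 1"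
proof (elim oddE)
  fix t assume u: "u = 2 * t + 1"
  then have "u + 1 = 2 * (t + 1)" by simp
  then have 1: "refine (u + 1) = 2 * (int d * (t + 1))" by (simp only: refine_even)
  have 2: "refine u = 2 * (int d * t + int r) + 1" by (simp only: u refine_odd)
  show ?thesis unfolding width_def 1 2 by (simp add: algebra_simps)
qed

text \<open>Hence children number 0 and 1 always exist, and they have different types.\<close>

lemma width_ge: "3 \<le> width u"
  using r by (cases "even u") (auto simp: width_even width_odd)

text \<open>So the leftmost child has its parent's type, and child \<open>i\<close> has type
  \<open>ptype (u + i)\<close>.\<close>

lemma even_refine: "even (refine u) \<longleftrightarrow> even u"
  by (simp add: refine_def)

text \<open>The characteristic vector of child number \<open>i\<close> (from 0) of any interval of type
  \<open>ptype u\<close>; only the parity of \<open>u\<close> matters.\<close>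

definition child_vec :: "int \<Rightarrow> int \<Rightarrow> char_vector" where
  "child_vec u i = (ptype (u + i), card {j \<in> {0..i}. fst (ptype (u + j)) = fst (ptype (u + i))})"

abbreviation cv :: "nat \<Rightarrow> real \<times> real \<Rightarrow> char_vector" where
  "cv \<equiv> char_vec d m K"

lemma inj_piece: "inj (piece n)"
  by (auto simp: inj_def piece_def)

text \<open>Siblings are consecutive pieces, so the position counts earlier offsets of equal length.
  Lengths rather than types are compared because both types may have the same length. The index
  \<open>w\<close> may be any of the same parity as \<open>u\<close>.\<close>

lemma char_vec_child:
  assumes u: "u \<in> ess n" and i: "0 \<le> i" "i < width u" and v: "v = refine u + i"
    and w: "even w \<longleftrightarrow> even u"
  shows "cv (Suc n) (piece (Suc n) v) = child_vec w i"
proof -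
  let ?P = "piece (Suc n)"
  have v': "refine u \<le> v" "v < refine (u + 1)" using i v by (auto simp: width_def)
  have pt: "ptype (refine u + j) = ptype (w + j)" for j
    using w by (simp add: ptype_eq_iff even_refine)
  have "?P v \<in> children d m K n (piece n u)"
    using v' by (simp add: children_piece[OF u])
  then have "parent d m K (Suc n) (?P v) = piece n u" by (simp add: children_def)
  then have "{\<Delta>' \<in> net d m K (Suc n). parent d m K (Suc n) \<Delta>' = parent d m K (Suc n) (?P v) \<and>
      norm_length d (Suc n) \<Delta>' = norm_length d (Suc n) (?P v) \<and> fst \<Delta>' \<le> fst (?P v)}
    = {\<Delta>' \<in> children d m K n (piece n u).
        norm_length d (Suc n) \<Delta>' = norm_length d (Suc n) (?P v) \<and> fst \<Delta>' \<le> fst (?P v)}"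
    unfolding children_def by auto
  also have "\<dots> = ?P ` {x \<in> {refine u..<refine (u + 1)}. fst (ptype x) = fst (ptype v) \<and> x \<le> v}"
    unfolding children_piece[OF u] by (auto simp: norm_length_piece) (auto simp: piece_def)
  also have "{x \<in> {refine u..<refine (u + 1)}. fst (ptype x) = fst (ptype v) \<and> x \<le> v}
    = (\<lambda>j. refine u + j) ` {j \<in> {0..i}. fst (ptype (w + j)) = fst (ptype (w + i))}"
  proof (intro equalityI subsetI)
    fix x assume "x \<in> {x \<in> {refine u..<refine (u + 1)}. fst (ptype x) = fst (ptype v) \<and> x \<le> v}"
    then show "x \<in> (\<lambda>j. refine u + j) ` {j \<in> {0..i}. fst (ptype (w + j)) = fst (ptype (w + i))}"
      using v pt[of "x - refine u"] pt[of i] by (intro image_eqI[of _ _ "x - refine u"]) auto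
  next
    fix x assume "x \<in> (\<lambda>j. refine u + j) ` {j \<in> {0..i}. fst (ptype (w + j)) = fst (ptype (w + i))}"
    then show "x \<in> {x \<in> {refine u..<refine (u + 1)}. fst (ptype x) = fst (ptype v) \<and> x \<le> v}"
      using v v' pt by auto
  qed
  finally have "position d m K (Suc n) (?P v) = card (?P ` (\<lambda>j. refine u + j) `
      {j \<in> {0..i}. fst (ptype (w + j)) = fst (ptype (w + i))})"
    by (simp add: position_def)
  also have "\<dots> = card {j \<in> {0..i}. fst (ptype (w + j)) = fst (ptype (w + i))}"
    by (simp add: card_image inj_on_subset[OF inj_piece])
  finally show ?thesis
    using red_vec_piece[OF refine_range_ess[OF u v']] v pt by (simp add: char_vec_def child_vec_def)
qed

text \<open>The reduced vector fixes the parity of the index, and parity fixes the vectors of the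
  children, so any interval representing \<open>\<alpha>\<close> serves.\<close>

lemma parent_rel_ptype:
  assumes "\<alpha> \<in> char_vecs d m K" "fst \<alpha> = ptype w"
  shows "(\<alpha>, \<beta>) \<in> parent_rel d m K \<longleftrightarrow> (\<exists>i. 0 \<le> i \<and> i < width w \<and> \<beta> = child_vec w i)"
proof -
  have weq: "width u = width w" if "even u \<longleftrightarrow> even w" for u
    using that width_even width_odd by metis
  show ?thesis
  proof
    assume "(\<alpha>, \<beta>) \<in> parent_rel d m K"
    then obtain n \<Delta> \<Delta>' where *: "\<alpha> = cv n \<Delta>" "\<beta> = cv (Suc n) \<Delta>'" "\<Delta> \<in> net d m K n"
        "\<Delta>' \<in> children d m K n \<Delta>"
      unfolding parent_rel_def by blast
    then have "red_vec d m n \<Delta> = ptype w" using assms(2) by (simp add: char_vec_def)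
    then obtain u where u: "u \<in> ess n" "\<Delta> = piece n u" "even u \<longleftrightarrow> even w"
      using red_vec_ptypeE *(3) by blast
    then obtain v where v: "\<Delta>' = piece (Suc n) v" "refine u \<le> v" "v < refine (u + 1)"
      using *(4) children_piece by auto
    have "0 \<le> v - refine u \<and> v - refine u < width w \<and> \<beta> = child_vec w (v - refine u)"
      using v char_vec_child[OF u(1), of "v - refine u" v w] u *(2) weq[OF u(3)] by (simp add: width_def)
    then show "\<exists>i. 0 \<le> i \<and> i < width w \<and> \<beta> = child_vec w i" by blast
  next
    assume "\<exists>i. 0 \<le> i \<and> i < width w \<and> \<beta> = child_vec w i"
    then obtain i where i: "0 \<le> i" "i < width w" "\<beta> = child_vec w i" by blast
    obtain n \<Delta> where *: "\<alpha> = cv n \<Delta>" "\<Delta> \<in> net d m K n"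
      using assms(1) by (auto simp: char_vecs_def)
    then have "red_vec d m n \<Delta> = ptype w" using assms(2) by (simp add: char_vec_def)
    then obtain u where u: "u \<in> ess n" "\<Delta> = piece n u" "even u \<longleftrightarrow> even w"
      using red_vec_ptypeE *(2) by blast
    have "piece (Suc n) (refine u + i) \<in> children d m K n \<Delta>"
      using i weq[OF u(3)] children_piece[OF u(1)] u(2) by (simp add: width_def)
    moreover have "\<beta> = cv (Suc n) (piece (Suc n) (refine u + i))"
      using char_vec_child[OF u(1) i(1) _ refl, of w] i u weq[OF u(3)] by simp
    ultimately show "(\<alpha>, \<beta>) \<in> parent_rel d m K"
      using * unfolding parent_rel_def by blast
  qed
qed

lemma parent_rel_subset: "(\<alpha>, \<beta>) \<in> parent_rel d m K \<Longrightarrow> \<beta> \<in> char_vecs d m K"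
  unfolding parent_rel_def char_vecs_def children_def by blast

section \<open>The essential class: existence\<close>

definition ess_vecs :: "char_vector set" where
  "ess_vecs = {child_vec u i | u i. 0 \<le> i \<and> i < width u}"

lemma ess_vecs_subset: "ess_vecs \<subseteq> char_vecs d m K"
proof
  fix \<beta> assume "\<beta> \<in> ess_vecs"
  then obtain u i where ui: "\<beta> = child_vec u i" "0 \<le> i" "i < width u" by (auto simp: ess_vecs_def)
  \<comment> \<open>Since \<open>k < m\<close>, level 1 has intervals of both types;
    \<open>w\<close> indexes one with the parity of \<open>u\<close>.\<close>
  define w where "w = (if even u then 2 * int k else 2 * int k + 1)"
  have "w \<in> ess 1" using k_less_m by (simp add: w_def ess_def)
  then have w: "cv 1 (piece 1 w) \<in> char_vecs d m K" "fst (cv 1 (piece 1 w)) = ptype u"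
    using piece_net[of w 1] red_vec_piece[of w 1] unfolding char_vecs_def
    by (blast, simp add: char_vec_def ptype_eq_iff w_def)
  then have "(cv 1 (piece 1 w), \<beta>) \<in> parent_rel d m K"
    using parent_rel_ptype ui by blast
  then show "\<beta> \<in> char_vecs d m K" by (rule parent_rel_subset)
qed

lemma fst_child_vec [simp]: "fst (child_vec u i) = ptype (u + i)"
  by (simp add: child_vec_def)

lemma ess_vecs_closed:
  assumes "\<alpha> \<in> ess_vecs" "(\<alpha>, \<beta>) \<in> parent_rel d m K"
  shows "\<beta> \<in> ess_vecs"
proof -
  obtain u i where "\<alpha> = child_vec u i" using assms by (auto simp: ess_vecs_def)
  then have "\<exists>i'. 0 \<le> i' \<and> i' < width (u + i) \<and> \<beta> = child_vec (u + i) i'"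
    using parent_rel_ptype[of \<alpha> "u + i" \<beta>] assms ess_vecs_subset by auto
  then show ?thesis by (auto simp: ess_vecs_def)
qed

text \<open>Two steps suffice: first to child 0 or 1 of \<open>\<alpha>\<close>, whichever has the
  type whose children include \<open>\<beta>\<close> (this is the choice of \<open>s\<close>), then
  to \<open>\<beta>\<close>.\<close>

lemma loop_class_ess_vecs: "loop_class d m K ess_vecs"
  unfolding loop_class_def
proof (intro conjI ballI ess_vecs_subset)
  have "child_vec 0 0 \<in> ess_vecs" using width_ge[of 0] by (force simp: ess_vecs_def)
  then show "ess_vecs \<noteq> {}" by blast
  fix \<alpha> \<beta> assume \<alpha>: "\<alpha> \<in> ess_vecs" and \<beta>: "\<beta> \<in> ess_vecs"
  obtain u i where u: "\<alpha> = child_vec u i" using \<alpha> by (auto simp: ess_vecs_def)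
  obtain v j where v: "\<beta> = child_vec v j" "0 \<le> j" "j < width v" using \<beta> by (auto simp: ess_vecs_def)
  define s :: int where "s = (if even (u + i) = even v then 0 else 1)"
  let ?\<gamma> = "child_vec (u + i) s"
  have s: "0 \<le> s" "s < width (u + i)" using width_ge[of "u + i"] by (auto simp: s_def)
  have \<gamma>: "?\<gamma> \<in> ess_vecs" using s by (auto simp: ess_vecs_def)
  have "\<alpha> \<in> char_vecs d m K" "fst \<alpha> = ptype (u + i)" using \<alpha> ess_vecs_subset u by auto
  then have "(\<alpha>, ?\<gamma>) \<in> parent_rel d m K" using parent_rel_ptype s by blast
  moreover have "fst ?\<gamma> = ptype v" by (auto simp: s_def ptype_eq_iff)
  then have "(?\<gamma>, \<beta>) \<in> parent_rel d m K"
    using parent_rel_ptype[of ?\<gamma> v] \<gamma> ess_vecs_subset v by blast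
  ultimately have "(\<alpha>, ?\<gamma>) \<in> parent_rel d m K \<inter> ess_vecs \<times> ess_vecs"
      "(?\<gamma>, \<beta>) \<in> parent_rel d m K \<inter> ess_vecs \<times> ess_vecs"
    using \<alpha> \<beta> \<gamma> by blast+
  then show "(\<alpha>, \<beta>) \<in> (parent_rel d m K \<inter> ess_vecs \<times> ess_vecs)\<^sup>+"
    by (meson r_into_trancl trancl_into_trancl)
qed

section \<open>The essential class: uniqueness\<close>

text \<open>Climbing from parent to parent turns containment across levels into a path of
  characteristic vectors.\<close>

lemma ancestor_exists:
  assumes "\<Delta>' \<in> net d m K (n + j)"
  shows "\<exists>\<Delta> \<in> net d m K n. subinterval \<Delta>' \<Delta> \<and> (cv n \<Delta>, cv (n + j) \<Delta>') \<in> (parent_rel d m K)\<^sup>*"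
  using assms
proof (induction j arbitrary: \<Delta>')
  case 0
  have "subinterval \<Delta>' \<Delta>'" by (simp add: subinterval_def)
  then show ?case using 0 by (intro bexI[of _ \<Delta>']) simp_all
next
  case (Suc j)
  then have \<Delta>': "\<Delta>' \<in> net d m K (Suc (n + j))" by simp
  then obtain P where P: "P \<in> net d m K (n + j)" "subinterval \<Delta>' P"
    using net_Suc_subinterval by blast
  obtain \<Delta> where \<Delta>: "\<Delta> \<in> net d m K n" "subinterval P \<Delta>"
      "(cv n \<Delta>, cv (n + j) P) \<in> (parent_rel d m K)\<^sup>*"
    using Suc.IH[OF P(1)] by blast
  have "\<Delta>' \<in> children d m K (n + j) P"
    using mem_children_iff P \<Delta>' by simp
  then have "(cv (n + j) P, cv (Suc (n + j)) \<Delta>') \<in> parent_rel d m K"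
    using P unfolding parent_rel_def by blast
  then have "(cv n \<Delta>, cv (n + Suc j) \<Delta>') \<in> (parent_rel d m K)\<^sup>*"
    using \<Delta>(3) by simp
  moreover have "subinterval \<Delta>' \<Delta>" using P \<Delta> by (auto simp: subinterval_def)
  ultimately show ?case using \<Delta> by blast
qed

text \<open>After enough subdivisions \<open>\<Delta>\<close> is longer than the regions near 0 and 1 without intervals of
  type \<open>E\<close>.\<close>

lemma type_E_descendant:
  assumes "\<alpha> \<in> char_vecs d m K"
  shows "\<exists>\<beta> \<in> char_vecs d m K. (\<alpha>, \<beta>) \<in> (parent_rel d m K)\<^sup>* \<and> fst \<beta> = ptype 0"
proof -
  obtain n \<Delta> where \<alpha>: "\<alpha> = cv n \<Delta>" "\<Delta> \<in> net d m K n"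
    using assms by (auto simp: char_vecs_def)
  obtain u v where uv: "\<Delta> = (nd n u, nd n v)" "u \<in> idx n" "v \<in> idx n" "u < v"
    using \<alpha>(2) net_iff by blast
  \<comment> \<open>From \<open>j < 2 ^ j \<le> d ^ j\<close> the scaled length of
    \<open>\<Delta>\<close> at level \<open>n + j\<close> is at least
    \<open>D + 2 * m\<close>.\<close>
  define j where "j = nat (D + 2 * int m)"
  have j: "D + 2 * int m \<le> int d ^ j"
  proof -
    have "int j < int (2 ^ j)" by (metis less_exp of_nat_less_iff)
    also have "\<dots> \<le> int d ^ j" using r by (simp add: power_mono)
    finally show ?thesis using j_def by linarith
  qed
  have it: "nd n w = nd (n + j) ((refine ^^ j) w)" "node ((refine ^^ j) w) = int d ^ j * node w" for w
    by (induction j) (simp_all add: nd_refine node_refine)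
  let ?a = "(refine ^^ j) u" and ?b = "(refine ^^ j) v"
  have "node u + 1 \<le> node v" using node_less[OF uv(4)] by linarith
  then have "int d ^ j * (node u + 1) \<le> int d ^ j * node v" by (intro mult_left_mono) auto
  then have ab: "node ?a + int d ^ j \<le> node ?b" by (simp add: it algebra_simps)
  have a: "0 \<le> ?a" and b: "?b \<le> 2 * (M (n + j) + int k) + 1"
  proof -
    have "nd n 0 \<le> nd n u" using idx_bounds[OF uv(2)] by simp
    then have "nd (n + j) 0 \<le> nd (n + j) ?a" unfolding nd_0 it(1)[symmetric] .
    then show "0 \<le> ?a" by simp
    have "nd n v \<le> nd n (2 * (M n + int k) + 1)" using idx_bounds[OF uv(3)] by simp
    then have "nd (n + j) ?b \<le> nd (n + j) (2 * (M (n + j) + int k) + 1)"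
      unfolding nd_last it(1)[symmetric] .
    then show "?b \<le> 2 * (M (n + j) + int k) + 1" by simp
  qed
  \<comment> \<open>The first left end point after \<open>?a\<close> is moved on by \<open>k\<close>
    so that \<open>t \<ge> k\<close>. This costs at most \<open>D + D * k \<le> D + m\<close>, and
    the cylinder from \<open>D * t\<close> needs another \<open>m\<close>; that it still fits below
    \<open>?b\<close> gives \<open>t \<le> M (n + j)\<close>.\<close>
  define t where "t = ?a div 2 + 1 + int k"
  have "node (2 * (?a div 2)) \<le> node ?a" by (simp add: node_def)
  then have "D * (?a div 2) \<le> node ?a" by simp
  moreover have "D * t = D * (?a div 2) + D + D * int k" by (simp add: t_def algebra_simps)
  ultimately have t: "D * t + int m \<le> node ?b"
    using j ab int_m r_pos by (simp add: mult.commute)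
  have t_lt: "2 * (t + int k) + 1 \<le> ?b"
  proof (rule ccontr)
    assume "\<not> ?thesis"
    then have "node ?b < node (2 * (t + int k) + 1)" by (intro node_less) simp
    also have "\<dots> = D * t + int m" unfolding node_odd by (simp add: int_m algebra_simps)
    finally show False using t by simp
  qed
  have "int k \<le> t" using a by (simp add: t_def)
  moreover have "t \<le> M (n + j)" using t_lt b by simp
  ultimately have ess: "2 * t \<in> ess (n + j)" by (simp add: ess_def)
  have "?a \<le> 2 * t" "2 * t + 1 \<le> ?b" using t_lt k by (auto simp: t_def)
  then have sub: "subinterval (piece (n + j) (2 * t)) \<Delta>"
    unfolding uv(1) piece_def it(1) by (simp add: subinterval_nd)
  have net: "piece (n + j) (2 * t) \<in> net d m K (n + j)" using piece_net[OF ess] .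
  then obtain \<Delta>2 where \<Delta>2: "\<Delta>2 \<in> net d m K n" "subinterval (piece (n + j) (2 * t)) \<Delta>2"
      "(cv n \<Delta>2, cv (n + j) (piece (n + j) (2 * t))) \<in> (parent_rel d m K)\<^sup>*"
    using ancestor_exists by blast
  \<comment> \<open>The ancestor found and \<open>\<Delta>\<close> both contain the new piece, so
    the path does start at \<open>\<alpha>\<close>.\<close>
  have "\<Delta>2 = \<Delta>" using net_overlap[OF \<Delta>2(1) \<alpha>(2) \<Delta>2(2) sub net_nonempty[OF net]] .
  moreover have "fst (cv (n + j) (piece (n + j) (2 * t))) = ptype 0"
    using red_vec_piece[OF ess] by (simp add: char_vec_def ptype_eq_iff)
  moreover have "cv (n + j) (piece (n + j) (2 * t)) \<in> char_vecs d m K"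
    using net by (auto simp: char_vecs_def)
  ultimately show ?thesis using \<Delta>2 \<alpha> by blast
qed

lemma essential_class_closed:
  assumes "is_essential_class d m K X" "\<alpha> \<in> X" "(\<alpha>, \<beta>) \<in> (parent_rel d m K)\<^sup>*"
  shows "\<beta> \<in> X"
  using assms(3)
proof induction
  case (step \<beta> \<gamma>)
  then show ?case using assms(1) unfolding is_essential_class_def by blast
qed (rule assms(2))

text \<open>All of \<open>X\<close> is reachable from the common element, and \<open>Y\<close> is
  closed under reachability; exchanging the roles gives equality.\<close>

lemma essential_classes_meet:
  assumes X: "is_essential_class d m K X" and Y: "is_essential_class d m K Y"
    and "\<alpha> \<in> X" "\<alpha> \<in> Y"
  shows "X \<subseteq> Y"
proof
  fix \<beta> assume "\<beta> \<in> X"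
  then have "(\<alpha>, \<beta>) \<in> (parent_rel d m K \<inter> X \<times> X)\<^sup>+"
    using X \<open>\<alpha> \<in> X\<close> by (simp add: is_essential_class_def loop_class_def)
  then have "(\<alpha>, \<beta>) \<in> (parent_rel d m K)\<^sup>+" by (rule trancl_mono) auto
  then show "\<beta> \<in> Y" using essential_class_closed[OF Y \<open>\<alpha> \<in> Y\<close>] by (simp add: trancl_into_rtrancl)
qed

lemma essential_class_eq: "essential_class d m K = ess_vecs"
  unfolding essential_class_def
proof (rule the_equality)
  show E: "is_essential_class d m K ess_vecs"
    using loop_class_ess_vecs ess_vecs_closed by (auto simp: is_essential_class_def)
  fix Y assume Y: "is_essential_class d m K Y"
  then obtain \<alpha> where \<alpha>: "\<alpha> \<in> Y" "\<alpha> \<in> char_vecs d m K"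
    by (auto simp: is_essential_class_def loop_class_def)
  then obtain \<beta> where \<beta>: "\<beta> \<in> char_vecs d m K" "(\<alpha>, \<beta>) \<in> (parent_rel d m K)\<^sup>*" "fst \<beta> = ptype 0"
    using type_E_descendant by blast
  \<comment> \<open>The position in \<open>\<beta>\<close> may not occur in \<open>ess_vecs\<close>,
    so one more step is taken, to its first child.\<close>
  then have "(\<beta>, child_vec 0 0) \<in> parent_rel d m K"
    using parent_rel_ptype[of \<beta> 0] width_ge[of 0] by auto
  then have "child_vec 0 0 \<in> Y"
    using essential_class_closed[OF Y \<alpha>(1)] \<beta>(2) by (meson rtrancl.rtrancl_into_rtrancl)
  moreover have "child_vec 0 0 \<in> ess_vecs" using width_ge[of 0] by (force simp: ess_vecs_def)
  ultimately show "Y = ess_vecs"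
    using essential_classes_meet E Y by blast
qed

lemma reduced_essential_class_eq:
  "reduced_essential_class d m K = {type_E d k r m, type_F d k r m}"
proof -
  have "child_vec 0 0 \<in> ess_vecs" "child_vec 1 0 \<in> ess_vecs"
    using width_ge[of 0] width_ge[of 1] by (force simp: ess_vecs_def)+
  then have "ptype 0 \<in> fst ` ess_vecs" "ptype 1 \<in> fst ` ess_vecs"
    by (metis add_0_right fst_child_vec imageI)+
  moreover have "ptype 0 = type_E d k r m" "ptype 1 = type_F d k r m"
    by (simp_all add: ptype_def)
  moreover have "fst ` ess_vecs \<subseteq> {type_E d k r m, type_F d k r m}"
    by (auto simp: ess_vecs_def child_vec_def ptype_def)
  ultimately show ?thesis
    unfolding reduced_essential_class_def essential_class_eq
    by (intro subset_antisym) simp_all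
qed

lemma essential_net_eq: "essential_net d m K n = piece n ` ess n"
proof (intro equalityI subsetI)
  fix \<Delta> assume "\<Delta> \<in> essential_net d m K n"
  then have "\<Delta> \<in> net d m K n" "red_vec d m n \<Delta> = ptype 0 \<or> red_vec d m n \<Delta> = ptype 1"
    by (auto simp: essential_net_def reduced_essential_class_eq ptype_def)
  then show "\<Delta> \<in> piece n ` ess n" using red_vec_ptypeE by blast
next
  fix \<Delta> assume "\<Delta> \<in> piece n ` ess n"
  then show "\<Delta> \<in> essential_net d m K n"
    using piece_net red_vec_piece by (auto simp: essential_net_def reduced_essential_class_eq ptype_def)
qed

section \<open>Lists of consecutive net intervals\<close>

definition pieces :: "nat \<Rightarrow> int \<Rightarrow> nat \<Rightarrow> (real \<times> real) list" where
  "pieces n s L = map (\<lambda>i. piece n (s + int i)) [0..<L]"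

lemma length_pieces [simp]: "length (pieces n s L) = L"
  and nth_pieces [simp]: "i < L \<Longrightarrow> pieces n s L ! i = piece n (s + int i)"
  by (simp_all add: pieces_def)

lemma lists_left_to_right_pieces:
  "lists_left_to_right (pieces n s L) (piece n ` {s..<s + int L})"
proof -
  have "(\<lambda>i. s + int i) ` {0..<L} = {s..<s + int L}"
    by (auto simp: image_iff intro!: bexI[of _ "nat (_ - s)"])
  moreover have "set (pieces n s L) = piece n ` (\<lambda>i. s + int i) ` {0..<L}"
    by (auto simp: pieces_def)
  ultimately have "set (pieces n s L) = piece n ` {s..<s + int L}"
    by simp
  moreover have "sorted_wrt (<) (map fst (pieces n s L))"
    by (simp add: pieces_def sorted_wrt_map sorted_wrt_iff_nth_less piece_def)
  ultimately show ?thesis by (simp add: lists_left_to_right_def)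
qed

lemma card_type_pieces:
  assumes "A \<subseteq> ess n"
  shows "card {\<Delta> \<in> piece n ` A. red_vec d m n \<Delta> = ptype w} = card {u \<in> A. even u \<longleftrightarrow> even w}"
proof -
  have "{\<Delta> \<in> piece n ` A. red_vec d m n \<Delta> = ptype w} = piece n ` {u \<in> A. even u \<longleftrightarrow> even w}"
    using assms red_vec_piece by (auto simp: ptype_eq_iff subset_iff)
  then show ?thesis by (simp add: card_image inj_on_subset[OF inj_piece])
qed

text \<open>Both types at once: the list starts at index \<open>refine u\<close>, and parity alone
  gives types and matrix sizes.\<close>

lemma children_list:
  assumes u: "u \<in> ess n" and L: "int L = width u"
  shows "lists_left_to_right (pieces (Suc n) (refine u) L) (children d m K n (piece n u))"
    and "i < L \<Longrightarrow> refine u + int i \<in> ess (Suc n)"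
    and "i < L \<Longrightarrow> red_vec d m (Suc n) (pieces (Suc n) (refine u) L ! i) = ptype (u + int i)"
    and "i < L \<Longrightarrow> prim_trans d m p n (piece n u) (pieces (Suc n) (refine u) L ! i) =
      mat (nbs u) (nbs (u + int i)) (\<lambda>(x, y). p_ext m p
        ((refine u + int i) div 2 - int y - int d * (u div 2 - int x)))"
proof -
  have "refine u + int L = refine (u + 1)" using L by (simp add: width_def)
  then show "lists_left_to_right (pieces (Suc n) (refine u) L) (children d m K n (piece n u))"
    using lists_left_to_right_pieces[of "Suc n" "refine u" L] by (simp add: children_piece[OF u])
  show e: "refine u + int i \<in> ess (Suc n)" if "i < L"
    using refine_range_ess[OF u, of "refine u + int i"] that L by (simp add: width_def)
  show "red_vec d m (Suc n) (pieces (Suc n) (refine u) L ! i) = ptype (u + int i)" if "i < L"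
    using red_vec_piece[OF e[OF that]] that by (simp add: ptype_eq_iff even_refine)
  show "prim_trans d m p n (piece n u) (pieces (Suc n) (refine u) L ! i) =
      mat (nbs u) (nbs (u + int i)) (\<lambda>(x, y). p_ext m p
        ((refine u + int i) div 2 - int y - int d * (u div 2 - int x)))" if "i < L"
    using prim_trans_piece[OF u e[OF that]] that by (simp add: nbs_def even_refine)
qed

section \<open>Essential net intervals of level one\<close>

lemma ess_1: "ess 1 = {2 * int k..2 * int m}"
  by (simp add: ess_def)

lemma level_one_list:
  "\<exists>xs. lists_left_to_right xs (essential_net d m K 1) \<and> xs \<noteq> [] \<and>
     (\<forall>i < length xs. red_vec d m 1 (xs ! i) =
        (if even i then type_E d k r m else type_F d k r m)) \<and>
     hd xs = (1 / d - r / (m * d), 1 / d) \<and>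
     last xs = (1 - 1 / d, 1 - (1 / d - r / (m * d)))"
proof (intro exI[of _ "pieces 1 (2 * int k) (2 * (m - k) + 1)"] conjI allI impI)
  let ?L = "2 * (m - k) + 1"
  let ?xs = "pieces 1 (2 * int k) ?L"
  have L: "2 * int k + int ?L = 2 * int m + 1" using k_less_m by simp
  then have "{2 * int k..<2 * int k + int ?L} = ess 1" unfolding ess_1 by auto
  then show "lists_left_to_right ?xs (essential_net d m K 1)"
    using lists_left_to_right_pieces[of 1 "2 * int k" ?L] by (simp add: essential_net_eq)
  show ne: "?xs \<noteq> []" by (metis length_pieces list.size(3) add_is_0 one_neq_zero)
  show "red_vec d m 1 (?xs ! i) = (if even i then type_E d k r m else type_F d k r m)"
    if "i < length ?xs" for i
  proof -
    have "2 * int k + int i \<in> ess 1" using that L unfolding ess_1 by simp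
    then show ?thesis using red_vec_piece[of "2 * int k + int i" 1] that by (simp add: ptype_def)
  qed
  have pos: "0 < real m" "0 < real d" "real_of_int D = real d - 1"
    using m_pos d_pos by (simp_all add: D_def)
  \<comment> \<open>This puts the first left end at \<open>(m - r) / (m d)\<close> and its right end
    at \<open>1 / d\<close>.\<close>
  have "D * int k = int m - int r" by (simp add: int_m)
  then have mr: "real_of_int (D * int k) = real m - real r" "real_of_int (D * int k + int r) = real m"
    by simp_all
  have "hd ?xs = piece 1 (2 * int k)"
    using ne hd_conv_nth[of ?xs] by simp
  also have "\<dots> = (1 / d - r / (m * d), 1 / d)"
    unfolding piece_def nd_def node_even node_odd mr using pos by (simp add: field_simps)
  finally show "hd ?xs = (1 / d - r / (m * d), 1 / d)" .
  have "last ?xs = piece 1 (2 * int m)"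
    using ne last_conv_nth[of ?xs] k_less_m by simp
  also have "\<dots> = (1 - 1 / d, 1 - (1 / d - r / (m * d)))"
    unfolding piece_def nd_def node_even node_odd using pos(1,2) by (simp add: pos(3) field_simps)
  finally show "last ?xs = (1 - 1 / d, 1 - (1 / d - r / (m * d)))" .
qed

lemma card_level_one:
  "card {\<Delta> \<in> essential_net d m K 1. red_vec d m 1 \<Delta> = type_E d k r m} = m - k + 1"
  "card {\<Delta> \<in> essential_net d m K 1. red_vec d m 1 \<Delta> = type_F d k r m} = m - k"
proof -
  have "{u \<in> ess 1. even u} = (\<lambda>t. 2 * t) ` {int k..int m}"
    unfolding ess_1 by (auto elim!: evenE)
  then have "card {u \<in> ess 1. even u} = m - k + 1"
    using k_less_m by (simp add: card_image inj_on_def)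
  then show "card {\<Delta> \<in> essential_net d m K 1. red_vec d m 1 \<Delta> = type_E d k r m} = m - k + 1"
    using card_type_pieces[of "ess 1" 1 0] by (simp add: essential_net_eq ptype_def)
  have "{u \<in> ess 1. odd u} = (\<lambda>t. 2 * t + 1) ` {int k..<int m}"
    unfolding ess_1 by (auto elim!: oddE)
  then have "card {u \<in> ess 1. odd u} = m - k"
    using k_less_m by (simp add: card_image inj_on_def)
  then show "card {\<Delta> \<in> essential_net d m K 1. red_vec d m 1 \<Delta> = type_F d k r m} = m - k"
    using card_type_pieces[of "ess 1" 1 1] by (simp add: essential_net_eq ptype_def)
qed

section \<open>Children and transition matrices of the two types\<close>

lemma type_E_children:
  assumes "\<Delta> \<in> net d m K n" "red_vec d m n \<Delta> = type_E d k r m"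
  shows "\<exists>xs. lists_left_to_right xs (children d m K n \<Delta>) \<and> length xs = 2 * r + 1 \<and>
     (\<forall>i < length xs. red_vec d m (Suc n) (xs ! i) =
        (if even i then type_E d k r m else type_F d k r m)) \<and>
     (\<forall>i \<in> {0..r}. prim_trans d m p n \<Delta> (xs ! (2 * i)) =
        mat (k + 1) (k + 1) (\<lambda>(x, y). p_ext m p (int d * int x - int y + int i))) \<and>
     (\<forall>i \<in> {1..r}. prim_trans d m p n \<Delta> (xs ! (2 * i - 1)) =
        mat (k + 1) k (\<lambda>(x, y). p_ext m p (int d * int x - int y + int i - 1)))"
proof -
  have "red_vec d m n \<Delta> = ptype 0" using assms(2) by (simp add: ptype_def)
  then obtain u where u: "u \<in> ess n" "\<Delta> = piece n u" "even u"
    using red_vec_ptypeE[OF assms(1)] by force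
  then obtain t where t: "u = 2 * t" by (auto elim: evenE)
  have L: "int (2 * r + 1) = width u" using u(3) by (simp add: width_even)
  note ch = children_list[OF u(1) L, folded u(2)]
  \<comment> \<open>List positions start at 0: the child labelled \<open>2i+1\<close> is at position
    \<open>2 * i\<close>, with half index \<open>d * t + i\<close>.\<close>
  have half: "(refine u + int (2 * i)) div 2 = int d * t + int i" for i
    unfolding t refine_even by simp
  \<comment> \<open>The child labelled \<open>2i\<close> is at position \<open>2 * i - 1\<close>;
    its index is odd, and halving it produces the extra \<open>- 1\<close> in the letter.\<close>
  have half': "(refine u + int (2 * i - 1)) div 2 = int d * t + int i - 1" if "1 \<le> i" for i
  proof -
    have "refine u + int (2 * i - 1) = 2 * (int d * t + int i - 1) + 1"
      unfolding t refine_even using that by simp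
    then show ?thesis by simp
  qed
  have letter: "int d * t + int i - int y - int d * (u div 2 - int x) = int d * int x - int y + int i"
    and letter': "int d * t + int i - 1 - int y - int d * (u div 2 - int x)
      = int d * int x - int y + int i - 1" for i x y
    unfolding t by (simp_all add: algebra_simps)
  show ?thesis
  proof (intro exI[of _ "pieces (Suc n) (refine u) (2 * r + 1)"] conjI ballI allI impI ch(1))
    fix i assume "i < length (pieces (Suc n) (refine u) (2 * r + 1))"
    then show "red_vec d m (Suc n) (pieces (Suc n) (refine u) (2 * r + 1) ! i) =
        (if even i then type_E d k r m else type_F d k r m)"
      using ch(3)[of i] u(3) by (simp add: ptype_def)
  next
    fix i assume i: "i \<in> {0..r}"
    show "prim_trans d m p n \<Delta> (pieces (Suc n) (refine u) (2 * r + 1) ! (2 * i)) =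
        mat (k + 1) (k + 1) (\<lambda>(x, y). p_ext m p (int d * int x - int y + int i))"
    proof (subst ch(4), goal_cases)
      case 2
      show ?case unfolding half letter using u(3) by (simp add: nbs_def)
    qed (use i in simp)
  next
    fix i assume i: "i \<in> {1..r}"
    show "prim_trans d m p n \<Delta> (pieces (Suc n) (refine u) (2 * r + 1) ! (2 * i - 1)) =
        mat (k + 1) k (\<lambda>(x, y). p_ext m p (int d * int x - int y + int i - 1))"
    proof (subst ch(4), goal_cases)
      case 2
      have "1 \<le> i" using i by simp
      show ?case unfolding half'[OF \<open>1 \<le> i\<close>] letter' using u(3) i by (simp add: nbs_def)
    qed (use i in auto)
  qed simp
qed

text \<open>Now \<open>refine u\<close> is odd, so the children labelled \<open>2i\<close> and
  \<open>2i+1\<close> share the half index \<open>d * t + r + i\<close>; hence both families of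
  matrices have the same letter formula.\<close>

lemma type_F_children:
  assumes "\<Delta> \<in> net d m K n" "red_vec d m n \<Delta> = type_F d k r m"
  shows "\<exists>xs. lists_left_to_right xs (children d m K n \<Delta>) \<and> length xs = 2 * (d - r) - 1 \<and>
     (\<forall>i < length xs. red_vec d m (Suc n) (xs ! i) =
        (if even i then type_F d k r m else type_E d k r m)) \<and>
     (\<forall>i \<in> {0..d - r - 1}. prim_trans d m p n \<Delta> (xs ! (2 * i)) =
        mat k k (\<lambda>(x, y). p_ext m p (int d * int x + int r - int y + int i))) \<and>
     (\<forall>i \<in> {1..d - r - 1}. prim_trans d m p n \<Delta> (xs ! (2 * i - 1)) =
        mat k (k + 1) (\<lambda>(x, y). p_ext m p (int d * int x + int r - int y + int i)))"
proof -
  have "red_vec d m n \<Delta> = ptype 1" using assms(2) by (simp add: ptype_def)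
  then obtain u where u: "u \<in> ess n" "\<Delta> = piece n u" "odd u"
    using red_vec_ptypeE[OF assms(1)] by force
  then obtain t where t: "u = 2 * t + 1" by (auto elim: oddE)
  let ?L = "2 * (d - r) - 1"
  have L: "int ?L = width u" using u(3) r by (simp add: width_odd)
  note ch = children_list[OF u(1) L, folded u(2)]
  have t': "u div 2 = t" by (simp add: t)
  have half: "(refine u + int (2 * i)) div 2 = int d * t + int r + int i" for i
  proof -
    have "refine u + int (2 * i) = 2 * (int d * t + int r + int i) + 1"
      unfolding t refine_odd by simp
    then show ?thesis by simp
  qed
  have half': "(refine u + int (2 * i - 1)) div 2 = int d * t + int r + int i" if "1 \<le> i" for i
  proof -
    have "refine u + int (2 * i - 1) = 2 * (int d * t + int r + int i)"
      unfolding t refine_odd using that by simp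
    then show ?thesis by simp
  qed
  have letter: "int d * t + int r + int i - int y - int d * (u div 2 - int x)
      = int d * int x + int r - int y + int i" for i x y
    unfolding t' by (simp add: algebra_simps)
  show ?thesis
  proof (intro exI[of _ "pieces (Suc n) (refine u) ?L"] conjI ballI allI impI ch(1))
    fix i assume "i < length (pieces (Suc n) (refine u) ?L)"
    then show "red_vec d m (Suc n) (pieces (Suc n) (refine u) ?L ! i) =
        (if even i then type_F d k r m else type_E d k r m)"
      using ch(3)[of i] u(3) by (simp add: ptype_def)
  next
    fix i assume i: "i \<in> {0..d - r - 1}"
    show "prim_trans d m p n \<Delta> (pieces (Suc n) (refine u) ?L ! (2 * i)) =
        mat k k (\<lambda>(x, y). p_ext m p (int d * int x + int r - int y + int i))"
    proof (subst ch(4), goal_cases)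
      case 2
      show ?case unfolding half letter using u(3) by (simp add: nbs_def)
    qed (use i r in auto)
  next
    fix i assume i: "i \<in> {1..d - r - 1}"
    show "prim_trans d m p n \<Delta> (pieces (Suc n) (refine u) ?L ! (2 * i - 1)) =
        mat k (k + 1) (\<lambda>(x, y). p_ext m p (int d * int x + int r - int y + int i))"
    proof (subst ch(4), goal_cases)
      case 2
      have "1 \<le> i" using i by simp
      show ?case unfolding half'[OF \<open>1 \<le> i\<close>] letter using u(3) i by (simp add: nbs_def)
    qed (use i in auto)
  qed simp
qed

end

theorem proposition5p4:
  fixes d k r m :: nat and p :: "nat \<Rightarrow> real" and \<mu> :: "real measure" and K :: "real set"
  assumes k: "k \<ge> 1" and r: "1 \<le> r" "r + 2 \<le> d"
    and m: "m = k * (d - 1) + r"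
    and p: "\<And>j. j \<le> m \<Longrightarrow> p j > 0" "(\<Sum>j = 0..m. p j) = 1"
    and \<mu>: "self_similar_measure d m p \<mu>"
    and K: "K = supp_measure \<mu>"
  shows
    \<comment> \<open>(1)\<close>
    "reduced_essential_class d m K = {type_E d k r m, type_F d k r m} \<and>
     type_E d k r m \<noteq> type_F d k r m \<and>
     \<comment> \<open>(2)\<close>
     (\<exists>xs. lists_left_to_right xs (essential_net d m K 1) \<and> xs \<noteq> [] \<and>
        (\<forall>i < length xs. red_vec d m 1 (xs ! i) =
           (if even i then type_E d k r m else type_F d k r m)) \<and>
        hd xs = (1 / d - r / (m * d), 1 / d) \<and>
        last xs = (1 - 1 / d, 1 - (1 / d - r / (m * d)))) \<and>
     card {\<Delta> \<in> essential_net d m K 1. red_vec d m 1 \<Delta> = type_E d k r m} = m - k + 1 \<and>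
     card {\<Delta> \<in> essential_net d m K 1. red_vec d m 1 \<Delta> = type_F d k r m} = m - k \<and>
     \<comment> \<open>(3) and (4), for a net interval of type E and the list of its children\<close>
     (\<forall>n. \<forall>\<Delta> \<in> net d m K n. red_vec d m n \<Delta> = type_E d k r m \<longrightarrow>
        (\<exists>xs. lists_left_to_right xs (children d m K n \<Delta>) \<and> length xs = 2 * r + 1 \<and>
           (\<forall>i < length xs. red_vec d m (Suc n) (xs ! i) =
              (if even i then type_E d k r m else type_F d k r m)) \<and>
           (\<forall>i \<in> {0..r}. prim_trans d m p n \<Delta> (xs ! (2 * i)) =
              mat (k + 1) (k + 1) (\<lambda>(x, y). p_ext m p (int d * int x - int y + int i))) \<and>
           (\<forall>i \<in> {1..r}. prim_trans d m p n \<Delta> (xs ! (2 * i - 1)) =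
              mat (k + 1) k (\<lambda>(x, y). p_ext m p (int d * int x - int y + int i - 1))))) \<and>
     \<comment> \<open>(3) and (4), for a net interval of type F and the list of its children\<close>
     (\<forall>n. \<forall>\<Delta> \<in> net d m K n. red_vec d m n \<Delta> = type_F d k r m \<longrightarrow>
        (\<exists>xs. lists_left_to_right xs (children d m K n \<Delta>) \<and> length xs = 2 * (d - r) - 1 \<and>
           (\<forall>i < length xs. red_vec d m (Suc n) (xs ! i) =
              (if even i then type_F d k r m else type_E d k r m)) \<and>
           (\<forall>i \<in> {0..d - r - 1}. prim_trans d m p n \<Delta> (xs ! (2 * i)) =
              mat k k (\<lambda>(x, y). p_ext m p (int d * int x + int r - int y + int i))) \<and>
           (\<forall>i \<in> {1..d - r - 1}. prim_trans d m p n \<Delta> (xs ! (2 * i - 1)) =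
              mat k (k + 1) (\<lambda>(x, y). p_ext m p (int d * int x + int r - int y + int i)))))"
proof -
  interpret cantor_ifs d k r m using k r m by unfold_locales
  \<comment> \<open>The support contains \<open>[0,1]\<close> because all probabilities are
    positive.\<close>
  interpret cantor_net d k r m K
    using unit_interval_subset_supp[OF \<mu> p(1)] K by unfold_locales simp
  show ?thesis
    using reduced_essential_class_eq type_E_neq_type_F level_one_list card_level_one
      type_E_children[of _ _ p] type_F_children[of _ _ p]
    by (intro conjI allI impI ballI) assumption+
qed

end
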